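(* Let $K$ be a field, let $G$ be a graph and let $k\geq1$. Then $$\dim I(G)^{(k)}/I(G)^{k}=\max\{\alpha(G-N_{G}[C]) : C\in\mathcal{C}_{k}(G)\},$$ where $\mathcal{C}_{k}(G)=\{C : C\text{ is an induced odd cycle of }G\text{ with }|C|\leq 2k-1\}$ and the convention $\max\emptyset=\dim 0=-\infty$ is used.
   Context: All graphs are finite, without loops and multiple edges. For a graph $G$ on vertex set $[n]=\{1,\dots,n\}$ and the polynomial ring $S=K[x_1,\dots,x_n]$, the edge ideal is $I(G)=(x_ix_j : \{i,j\}\in E(G))\subset S$. For a squarefree monomial ideal $I$, the $k$-th symbolic power is $I^{(k)}=\bigcap_{P\in\operatorname{Min}(I)}P^k$, where $\operatorname{Min}(I)$ is the set of minimal primes of $I$; one always has $I^k\subset I^{(k)}$. $\dim$ denotes Krull dimension of an $S$-module. For a cycle $C$, $|C|$ is its length (number of vertices), and $N_G[C]$ is the closed neighborhood in $G$ of the vertex set of $C$ (the vertices of $C$ together with all their neighbors). For $A\subset V(G)$, $G-A$ is the induced subgraph on $V(G)\setminus A$. $\alpha(H)$ is the maximum size of an independent set of $H$ (so $\alpha(H)=0$ if $H$ has no vertices). *)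

theory Defs
  imports
    "Graph_Theory.Digraph_Component"
    "HOL-Library.Poly_Mapping"
    "HOL-Library.Extended_Real"
    "HOL-Algebra.QuotRing"
    "HOL-Algebra.Module"
    "HOL-Algebra.Ideal_Product"
begin

section \<open>Polynomial rings\<close>

text \<open>A monomial is a finitely supported exponent vector, a polynomial a finitely supported
  family of coefficients; \<open>mpoly_ring V\<close> is the polynomial ring in the variables indexed by \<open>V\<close>.\<close>

type_synonym 'k mpoly = "(nat \<Rightarrow>\<^sub>0 nat) \<Rightarrow>\<^sub>0 'k"

definition mpoly_ring :: "nat set \<Rightarrow> 'k::field mpoly ring" where
  "mpoly_ring V =
     \<lparr> carrier = {p. \<forall>m\<in>Poly_Mapping.keys p. Poly_Mapping.keys m \<subseteq> V},
       mult = (*), one = 1, zero = 0, add = (+) \<rparr>"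

definition mpoly_var :: "nat \<Rightarrow> 'k::field mpoly" where
  "mpoly_var i = Poly_Mapping.single (Poly_Mapping.single i 1) 1"

lemma cring_mpoly_ring: "cring (mpoly_ring V :: 'k::field mpoly ring)"
proof -
  define A where "A = {p :: 'k mpoly. \<forall>m\<in>Poly_Mapping.keys p. Poly_Mapping.keys m \<subseteq> V}"
  have A_iff: "p \<in> A \<longleftrightarrow> (\<forall>m\<in>Poly_Mapping.keys p. Poly_Mapping.keys m \<subseteq> V)" for p
    unfolding A_def by (rule mem_Collect_eq)
  have plus_closed: "p + q \<in> A" if "p \<in> A" "q \<in> A" for p q
    using that Poly_Mapping.keys_add[of p q] unfolding A_iff by blast
  have uminus_closed: "- p \<in> A" if "p \<in> A" for p
    using that unfolding A_iff by simp
  have times_closed: "p * q \<in> A" if p: "p \<in> A" and q: "q \<in> A" for p q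
    unfolding A_iff
  proof
    fix m assume "m \<in> Poly_Mapping.keys (p * q)"
    then obtain a b where "m = a + b" "a \<in> Poly_Mapping.keys p" "b \<in> Poly_Mapping.keys q"
      using Poly_Mapping.keys_mult[of p q] by blast
    then show "Poly_Mapping.keys m \<subseteq> V"
      using p q Poly_Mapping.keys_add[of a b] unfolding A_iff by blast
  qed
  have zero_closed: "0 \<in> A" and one_closed: "1 \<in> A"
    unfolding A_iff by simp_all
  define S :: "'k mpoly ring" where "S = \<lparr> carrier = A, mult = (*), one = 1, zero = 0, add = (+) \<rparr>"
  have S: "carrier S = A" "mult S = (*)" "one S = 1" "zero S = 0" "add S = (+)"
    unfolding S_def by simp_all
  have "cring S"
  proof (rule cringI)
    show "abelian_group S"
    proof (rule abelian_groupI, unfold S)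
      fix p assume "p \<in> A"
      show "\<exists>q\<in>A. q + p = 0"
        using uminus_closed[OF \<open>p \<in> A\<close>] by (rule bexI[rotated]) (rule left_minus)
    qed (rule plus_closed zero_closed add.assoc add.commute add_0_left; assumption?)+
    show "Group.comm_monoid S"
      by (rule Group.comm_monoidI, unfold S)
        (rule times_closed one_closed mult.assoc mult.commute mult_1_left; assumption?)+
    show "(p \<oplus>\<^bsub>S\<^esub> q) \<otimes>\<^bsub>S\<^esub> r = p \<otimes>\<^bsub>S\<^esub> r \<oplus>\<^bsub>S\<^esub> q \<otimes>\<^bsub>S\<^esub> r" for p q r
      unfolding S by (rule distrib_right)
  qed
  then show ?thesis
    unfolding S_def A_def mpoly_ring_def .
qed


section \<open>Symbolic powers and Krull dimension\<close>

definition minimal_primes :: "('a, 'b) ring_scheme \<Rightarrow> 'a set \<Rightarrow> 'a set set" where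
  "minimal_primes R I =
     {P. primeideal P R \<and> I \<subseteq> P \<and> (\<forall>Q. primeideal Q R \<and> I \<subseteq> Q \<and> Q \<subseteq> P \<longrightarrow> Q = P)}"

text \<open>\<open>ideals_set R\<close> is the library's monoid of ideals, so powers in it are the ordinary powers of
  ideals. Taking minimal primes (rather than all associated primes) is correct for squarefree
  monomial ideals, to which this is applied.\<close>

definition symbolic_power :: "('a, 'b) ring_scheme \<Rightarrow> 'a set \<Rightarrow> nat \<Rightarrow> 'a set" where
  "symbolic_power R I k = carrier R \<inter> (\<Inter>P\<in>minimal_primes R I. P [^]\<^bsub>ideals_set R\<^esub> k)"

text \<open>The module \<open>J / I\<close> for ideals \<open>I \<subseteq> J\<close> of \<open>R\<close>. The record type of modules
  has superfluous fields \<open>mult\<close> and \<open>one\<close>, which play no role.\<close>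

definition quotient_module ::
  "('a, 'b) ring_scheme \<Rightarrow> 'a set \<Rightarrow> 'a set \<Rightarrow> ('a, 'a set) module" where
  "quotient_module R J I =
     \<lparr> carrier = (\<lambda>a. I +>\<^bsub>R\<^esub> a) ` J, mult = undefined, one = undefined,
       zero = I, add = set_add R,
       smult = (\<lambda>r X. \<Union>x\<in>X. I +>\<^bsub>R\<^esub> (r \<otimes>\<^bsub>R\<^esub> x)) \<rparr>"

definition annihilator ::
  "('a, 'b) ring_scheme \<Rightarrow> ('a, 'c, 'd) module_scheme \<Rightarrow> 'a set" where
  "annihilator R M = {r \<in> carrier R. \<forall>x\<in>carrier M. r \<odot>\<^bsub>M\<^esub> x = \<zero>\<^bsub>M\<^esub>}"

text \<open>The supremum is taken in the extended reals, so that the zero ring, which has no prime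
  ideals, and hence the zero module, has dimension \<open>-\<infinity>\<close>.\<close>

definition krull_dim :: "('a, 'b) ring_scheme \<Rightarrow> ereal" where
  "krull_dim R =
     Sup {ereal (real d) | d P.
       (\<forall>i\<le>d. primeideal (P i) R) \<and> (\<forall>i<d. P i \<subset> P (Suc i))}"

definition module_dim ::
  "('a, 'b) ring_scheme \<Rightarrow> ('a, 'c, 'd) module_scheme \<Rightarrow> ereal" where
  "module_dim R M = krull_dim (R Quot annihilator R M)"

lemma module_quotient_module:
  assumes R: "cring R" and I: "ideal I R" and J: "ideal J R" and "I \<subseteq> J"
  shows "module R (quotient_module R J I)"
proof -
  interpret cring R by (fact R)
  interpret I: ideal I R by (fact I)
  interpret J: ideal J R by (fact J)
  have Jc: "a \<in> carrier R" if "a \<in> J" for a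
    using that by (rule J.Icarr)
  have add: "(I +>\<^bsub>R\<^esub> a) <+>\<^bsub>R\<^esub> (I +>\<^bsub>R\<^esub> b) = I +>\<^bsub>R\<^esub> (a \<oplus>\<^bsub>R\<^esub> b)"
    if "a \<in> carrier R" "b \<in> carrier R" for a b
    using that by (rule I.a_rcos_sum)
  have zero: "I +>\<^bsub>R\<^esub> \<zero>\<^bsub>R\<^esub> = I"
    using I.a_subset by (rule a_coset_add_zero)
  have smult: "(\<Union>x\<in>I +>\<^bsub>R\<^esub> a. I +>\<^bsub>R\<^esub> (r \<otimes>\<^bsub>R\<^esub> x)) = I +>\<^bsub>R\<^esub> (r \<otimes>\<^bsub>R\<^esub> a)"
    if a: "a \<in> carrier R" and r: "r \<in> carrier R" for r a
  proof -
    have "I +>\<^bsub>R\<^esub> (r \<otimes>\<^bsub>R\<^esub> x) = I +>\<^bsub>R\<^esub> (r \<otimes>\<^bsub>R\<^esub> a)" if x: "x \<in> I +>\<^bsub>R\<^esub> a" for x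
    proof -
      obtain i where i: "i \<in> I" and xi: "x = i \<oplus>\<^bsub>R\<^esub> a"
        using x unfolding a_r_coset_def' by blast
      have ic: "i \<in> carrier R" using i by (rule I.Icarr)
      have ri: "r \<otimes>\<^bsub>R\<^esub> i \<in> I" using i r by (rule I.I_l_closed)
      have "r \<otimes>\<^bsub>R\<^esub> x = r \<otimes>\<^bsub>R\<^esub> i \<oplus>\<^bsub>R\<^esub> r \<otimes>\<^bsub>R\<^esub> a"
        unfolding xi by (rule r_distr[OF ic a r])
      then have "I +>\<^bsub>R\<^esub> (r \<otimes>\<^bsub>R\<^esub> x) = (I +>\<^bsub>R\<^esub> (r \<otimes>\<^bsub>R\<^esub> i)) <+>\<^bsub>R\<^esub> (I +>\<^bsub>R\<^esub> (r \<otimes>\<^bsub>R\<^esub> a))"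
        using add[of "r \<otimes>\<^bsub>R\<^esub> i" "r \<otimes>\<^bsub>R\<^esub> a"] a r ic by (metis m_closed)
      also have "I +>\<^bsub>R\<^esub> (r \<otimes>\<^bsub>R\<^esub> i) = I +>\<^bsub>R\<^esub> \<zero>\<^bsub>R\<^esub>"
        unfolding zero by (rule I.a_rcos_const[OF ri])
      also have "(I +>\<^bsub>R\<^esub> \<zero>\<^bsub>R\<^esub>) <+>\<^bsub>R\<^esub> (I +>\<^bsub>R\<^esub> (r \<otimes>\<^bsub>R\<^esub> a)) = I +>\<^bsub>R\<^esub> (r \<otimes>\<^bsub>R\<^esub> a)"
        unfolding add[OF zero_closed m_closed[OF r a]] l_zero[OF m_closed[OF r a]] ..
      finally show ?thesis .
    qed
    moreover have "a \<in> I +>\<^bsub>R\<^esub> a"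
      using a by (rule I.a_rcos_self)
    ultimately show ?thesis by blast
  qed
  have "abelian_group (quotient_module R J I)"
  proof (rule abelian_groupI, unfold quotient_module_def ring_record_simps partial_object.simps)
    show "I \<in> (\<lambda>a. I +>\<^bsub>R\<^esub> a) ` J"
      using zero J.zero_closed by (intro image_eqI[of _ _ "\<zero>\<^bsub>R\<^esub>"]) simp_all
  next
    fix X Y assume "X \<in> (\<lambda>a. I +>\<^bsub>R\<^esub> a) ` J" "Y \<in> (\<lambda>a. I +>\<^bsub>R\<^esub> a) ` J"
    then obtain a b where a: "a \<in> J" "X = I +>\<^bsub>R\<^esub> a" and b: "b \<in> J" "Y = I +>\<^bsub>R\<^esub> b"
      by blast
    have "X <+>\<^bsub>R\<^esub> Y = I +>\<^bsub>R\<^esub> (a \<oplus>\<^bsub>R\<^esub> b)"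
      unfolding a b by (rule add[OF Jc[OF a(1)] Jc[OF b(1)]])
    then show "X <+>\<^bsub>R\<^esub> Y \<in> (\<lambda>a. I +>\<^bsub>R\<^esub> a) ` J"
      using J.a_closed[OF a(1) b(1)] by (rule image_eqI)
    have "Y <+>\<^bsub>R\<^esub> X = I +>\<^bsub>R\<^esub> (b \<oplus>\<^bsub>R\<^esub> a)"
      unfolding a b by (rule add[OF Jc[OF b(1)] Jc[OF a(1)]])
    then show "X <+>\<^bsub>R\<^esub> Y = Y <+>\<^bsub>R\<^esub> X"
      using \<open>X <+>\<^bsub>R\<^esub> Y = I +>\<^bsub>R\<^esub> (a \<oplus>\<^bsub>R\<^esub> b)\<close> a_comm[OF Jc[OF a(1)] Jc[OF b(1)]] by argo
    fix Z assume "Z \<in> (\<lambda>a. I +>\<^bsub>R\<^esub> a) ` J"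
    then obtain c where c: "c \<in> J" "Z = I +>\<^bsub>R\<^esub> c"
      by blast
    show "X <+>\<^bsub>R\<^esub> Y <+>\<^bsub>R\<^esub> Z = X <+>\<^bsub>R\<^esub> (Y <+>\<^bsub>R\<^esub> Z)"
      unfolding a b c using Jc[OF a(1)] Jc[OF b(1)] Jc[OF c(1)]
      by (simp only: add a_closed a_assoc)
  next
    fix X assume "X \<in> (\<lambda>a. I +>\<^bsub>R\<^esub> a) ` J"
    then obtain a where a: "a \<in> J" "X = I +>\<^bsub>R\<^esub> a"
      by blast
    have "(I +>\<^bsub>R\<^esub> \<zero>\<^bsub>R\<^esub>) <+>\<^bsub>R\<^esub> X = X"
      unfolding a using Jc[OF a(1)] by (simp only: add zero_closed l_zero)
    then show "I <+>\<^bsub>R\<^esub> X = X"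
      unfolding zero .
    have "(I +>\<^bsub>R\<^esub> (\<ominus>\<^bsub>R\<^esub> a)) <+>\<^bsub>R\<^esub> X = I"
      unfolding a using Jc[OF a(1)] by (simp only: add a_inv_closed l_neg zero)
    then show "\<exists>Y\<in>(\<lambda>a. I +>\<^bsub>R\<^esub> a) ` J. Y <+>\<^bsub>R\<^esub> X = I"
      using J.a_inv_closed[OF a(1)] by blast
  qed
  moreover have "module_axioms R (quotient_module R J I)"
  proof (rule module_axioms.intro, unfold quotient_module_def module.simps ring_record_simps partial_object.simps)
    fix r X assume r: "r \<in> carrier R" and "X \<in> (\<lambda>a. I +>\<^bsub>R\<^esub> a) ` J"
    then obtain a where a: "a \<in> J" "X = I +>\<^bsub>R\<^esub> a"
      by blast
    show "(\<Union>x\<in>X. I +>\<^bsub>R\<^esub> (r \<otimes>\<^bsub>R\<^esub> x)) \<in> (\<lambda>a. I +>\<^bsub>R\<^esub> a) ` J"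
      unfolding a smult[OF Jc[OF a(1)] r] using J.I_l_closed[OF a(1) r] by (rule imageI)
    fix s assume s: "s \<in> carrier R"
    show "(\<Union>x\<in>X. I +>\<^bsub>R\<^esub> ((r \<oplus>\<^bsub>R\<^esub> s) \<otimes>\<^bsub>R\<^esub> x)) =
        (\<Union>x\<in>X. I +>\<^bsub>R\<^esub> (r \<otimes>\<^bsub>R\<^esub> x)) <+>\<^bsub>R\<^esub> (\<Union>x\<in>X. I +>\<^bsub>R\<^esub> (s \<otimes>\<^bsub>R\<^esub> x))"
      unfolding a using Jc[OF a(1)] r s by (simp only: smult add a_closed m_closed l_distr)
    show "(\<Union>x\<in>X. I +>\<^bsub>R\<^esub> ((r \<otimes>\<^bsub>R\<^esub> s) \<otimes>\<^bsub>R\<^esub> x)) =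
        (\<Union>x\<in>(\<Union>x\<in>X. I +>\<^bsub>R\<^esub> (s \<otimes>\<^bsub>R\<^esub> x)). I +>\<^bsub>R\<^esub> (r \<otimes>\<^bsub>R\<^esub> x))"
      unfolding a using Jc[OF a(1)] r s by (simp only: smult m_closed m_assoc)
  next
    fix r X Y assume r: "r \<in> carrier R"
      and "X \<in> (\<lambda>a. I +>\<^bsub>R\<^esub> a) ` J" "Y \<in> (\<lambda>a. I +>\<^bsub>R\<^esub> a) ` J"
    then obtain a b where a: "a \<in> J" "X = I +>\<^bsub>R\<^esub> a" and b: "b \<in> J" "Y = I +>\<^bsub>R\<^esub> b"
      by blast
    show "(\<Union>x\<in>X <+>\<^bsub>R\<^esub> Y. I +>\<^bsub>R\<^esub> (r \<otimes>\<^bsub>R\<^esub> x)) =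
        (\<Union>x\<in>X. I +>\<^bsub>R\<^esub> (r \<otimes>\<^bsub>R\<^esub> x)) <+>\<^bsub>R\<^esub> (\<Union>x\<in>Y. I +>\<^bsub>R\<^esub> (r \<otimes>\<^bsub>R\<^esub> x))"
      unfolding a b using Jc[OF a(1)] Jc[OF b(1)] r
      by (simp only: smult add a_closed m_closed r_distr)
  next
    fix X assume "X \<in> (\<lambda>a. I +>\<^bsub>R\<^esub> a) ` J"
    then obtain a where a: "a \<in> J" "X = I +>\<^bsub>R\<^esub> a"
      by blast
    show "(\<Union>x\<in>X. I +>\<^bsub>R\<^esub> (\<one>\<^bsub>R\<^esub> \<otimes>\<^bsub>R\<^esub> x)) = X"
      unfolding a using Jc[OF a(1)] by (simp only: smult one_closed l_one)
  qed
  ultimately show ?thesis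
    by (intro module.intro R)
qed


section \<open>Graphs and edge ideals\<close>

text \<open>Finite simple graphs are the library's \<open>graph\<close>s: finite symmetric digraphs without loops and
  parallel arcs, an edge \<open>{u,v}\<close> being represented by the two arcs between \<open>u\<close> and \<open>v\<close>.\<close>

definition edge_ideal :: "nat \<Rightarrow> (nat, 'e) pre_digraph \<Rightarrow> 'k::field mpoly set" where
  "edge_ideal n G = genideal (mpoly_ring {1..n}) {mpoly_var i * mpoly_var j | i j. i \<rightarrow>\<^bsub>G\<^esub> j}"

definition cycle_graph :: "('a, 'e) pre_digraph \<Rightarrow> bool" where
  "cycle_graph C \<longleftrightarrow>
     (\<exists>vs. distinct vs \<and> 3 \<le> length vs \<and> verts C = set vs \<and>
       arcs_ends C =
         (\<Union>i<length vs. {(vs ! i, vs ! (Suc i mod length vs)),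
                           (vs ! (Suc i mod length vs), vs ! i)}))"

definition induced_odd_cycles :: "('a, 'e) pre_digraph \<Rightarrow> nat \<Rightarrow> ('a, 'e) pre_digraph set" where
  "induced_odd_cycles G k =
     {C. induced_subgraph C G \<and> cycle_graph C \<and> odd (card (verts C)) \<and> card (verts C) \<le> 2 * k - 1}"

definition closed_neighborhood :: "('a, 'e) pre_digraph \<Rightarrow> 'a set \<Rightarrow> 'a set" where
  "closed_neighborhood G A = A \<union> {v \<in> verts G. \<exists>u\<in>A. u \<rightarrow>\<^bsub>G\<^esub> v}"

definition delete_verts :: "('a, 'e) pre_digraph \<Rightarrow> 'a set \<Rightarrow> ('a, 'e) pre_digraph" where
  "delete_verts G A = G \<restriction> (verts G - A)"

definition independence_number :: "('a, 'e) pre_digraph \<Rightarrow> nat" where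
  "independence_number H =
     Max {card U | U. U \<subseteq> verts H \<and> (\<forall>u\<in>U. \<forall>v\<in>U. \<not> u \<rightarrow>\<^bsub>H\<^esub> v)}"

lemma finite_induced_odd_cycles:
  assumes "fin_digraph G"
  shows "finite (induced_odd_cycles G k)"
proof -
  interpret fin_digraph G by (fact assms)
  have "induced_odd_cycles G k \<subseteq>
      (\<lambda>(U, A). \<lparr> verts = U, arcs = A, tail = tail G, head = head G \<rparr>) `
        (Pow (verts G) \<times> Pow (arcs G))"
  proof
    fix C assume "C \<in> induced_odd_cycles G k"
    then have "subgraph C G"
      by (simp add: induced_odd_cycles_def induced_subgraph_def)
    then show "C \<in> (\<lambda>(U, A). \<lparr> verts = U, arcs = A, tail = tail G, head = head G \<rparr>) `
        (Pow (verts G) \<times> Pow (arcs G))"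
      by (intro image_eqI[of _ _ "(verts C, arcs C)"]) (auto simp: subgraph_def compatible_def)
  qed
  then show ?thesis
    by (rule finite_subset) (intro finite_imageI finite_cartesian_product,
        simp_all add: finite_verts finite_arcs)
qed

text \<open>The maximum of a finite set of extended reals, with the convention that the maximum of the
  empty set is \<open>-\<infinity>\<close>.\<close>

definition Max_or_minus_infty :: "ereal set \<Rightarrow> ereal" where
  "Max_or_minus_infty A = (if A = {} then - \<infinity> else Max A)"

end

theory Submission
  imports Defs
begin

text \<open>Write \<open>E\<close> for the set of edges, \<open>V = {1..n}\<close>, and identify a monomial with its exponent vector,
a weight \<open>a\<close> on the vertices. Both ideals are spanned by monomials. The weight \<open>a\<close> lies in the
\<open>k\<close>-th power of the edge ideal iff \<open>k\<close> edges, counted with repetition, fit under it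
(\<open>edge_ideal_power\<close>); it lies in the \<open>k\<close>-th symbolic power iff every vertex cover has weight at
least \<open>k\<close>, since the minimal primes are generated by the variables of minimal vertex covers
(\<open>symbolic_power_edge_ideal\<close>). So the quotient measures the gap between packing edges and covering
them.

The dimension is governed by the annihilator of the quotient. If a prime \<open>P\<close> starts a chain of
primes of length \<open>d\<close> in the polynomial ring, then \<open>d\<close> is at most the number of variables outside
\<open>P\<close> (\<open>prime_chain_length_le\<close>); the ideals generated by variables attain this bound. Hence the
dimension is the largest size of a set \<open>F\<close> of variables such that no monomial in \<open>F\<close> kills the
quotient, and it remains to recognise these sets.

Lower bound. Let \<open>C\<close> be an induced cycle with \<open>2 * r + 1 \<le> 2 * k - 1\<close> vertices and \<open>U\<close> an
independent set avoiding the closed neighbourhood of \<open>C\<close>. The product of the vertices of \<open>C\<close> with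
the \<open>(k - r - 1)\<close>-st power of an edge of \<open>C\<close> has weight at least \<open>k\<close> on every vertex cover. Its
degree on \<open>C\<close> is only \<open>2 * k - 1\<close>, and the vertices of \<open>U\<close> lie on no edge inside \<open>U\<close> and \<open>C\<close>, so
multiplying by monomials in \<open>U\<close> never makes room for \<open>k\<close> edges
(\<open>annihilator_subset_variable_ideal\<close>).

Upper bound. Suppose the \<open>k\<close>-th power of the product of \<open>F\<close> does not kill the quotient: it does not
make room for \<open>k\<close> edges over some weight \<open>a\<close> of the symbolic power. Then \<open>F\<close> is independent, and
each unit of weight on the set \<open>N\<close> of neighbours of \<open>F\<close> already provides an edge into \<open>F\<close>. Away
from \<open>F\<close> and \<open>N\<close>, all vertex covers still have weight at least \<open>s = k - a(N)\<close>, but \<open>s\<close> edges do not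
fit. On the support of \<open>a\<close> there, the graph cannot be bipartite by Koenig's theorem, so a shortest
odd closed walk is an induced cycle with some \<open>2 * r + 1\<close> vertices. This cycle contains \<open>r\<close>
disjoint edges, whence \<open>r < s\<close> and its length is at most \<open>2 * k - 1\<close>. It avoids the neighbourhood of
\<open>F\<close>, so \<open>F\<close> is one of the independent sets that the maximum ranges over
(\<open>induced_odd_cycle_away_from\<close>).\<close>

section \<open>Packing edges under a vertex weight\<close>

definition vertex_cover :: "'a rel \<Rightarrow> 'a set \<Rightarrow> bool" where
  "vertex_cover E D \<longleftrightarrow> (\<forall>(u, v)\<in>E. u \<in> D \<or> v \<in> D)"

text \<open>The weight \<open>a\<close> is at least the sum of \<open>k\<close> edges, each regarded as the indicator of its two ends and
allowed to repeat. The base rule admits every weight, which makes the predicate monotone in \<open>a\<close>.\<close>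

inductive packs :: "'a rel \<Rightarrow> nat \<Rightarrow> ('a \<Rightarrow> nat) \<Rightarrow> bool" for E where
  zero: "packs E 0 a"
| Suc: "packs E k a \<Longrightarrow> (u, v) \<in> E \<Longrightarrow> packs E (Suc k) (\<lambda>x. a x + of_bool (x = u) + of_bool (x = v))"

lemma packs_mono:
  assumes "packs E k a" "\<And>x. a x \<le> b x"
  shows "packs E k b"
  using assms
proof (induction arbitrary: b)
  case (zero a)
  show ?case by (rule packs.zero)
next
  case (Suc k a u v)
  define c where "c = (\<lambda>x. b x - of_bool (x = u) - of_bool (x = v))"
  have "packs E k c"
  proof (rule Suc.IH)
    fix x show "a x \<le> c x" using Suc.prems[of x] unfolding c_def by linarith
  qed
  from packs.Suc[OF this Suc.hyps(2)]
  have "packs E (Suc k) (\<lambda>x. c x + of_bool (x = u) + of_bool (x = v))" .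
  moreover have "c x + of_bool (x = u) + of_bool (x = v) = b x" for x
    using Suc.prems[of x] unfolding c_def by (auto simp: of_bool_def)
  ultimately show ?case by simp
qed

lemma packs_antimono:
  assumes "packs E k a" "j \<le> k"
  shows "packs E j a"
  using assms
proof (induction arbitrary: j)
  case (zero a)
  then show ?case by (simp add: packs.zero)
next
  case (Suc k a u v)
  show ?case
  proof (cases "j \<le> k")
    case True
    then have "packs E j a" by (rule Suc.IH)
    then show ?thesis by (rule packs_mono) simp
  next
    case False
    then have "j = Suc k" using Suc.prems by simp
    then show ?thesis using packs.Suc[OF Suc.hyps(1,2)] by simp
  qed
qed

lemma packs_add:
  assumes "packs E k a" "packs E l b"
  shows "packs E (k + l) (\<lambda>x. a x + b x)"
  using assms(1)
proof induction
  case (zero a)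
  show ?case using packs_mono[OF assms(2), of "\<lambda>x. a x + b x"] by simp
next
  case (Suc k a u v)
  from packs.Suc[OF Suc.IH Suc.hyps(2)] show ?case
    by (simp add: ac_simps)
qed

lemma packs_repeated_edge:
  assumes "(u, v) \<in> E"
  shows "packs E k (\<lambda>x. k * of_bool (x = u) + k * of_bool (x = v))"
proof (induction k)
  case 0
  show ?case by (rule packs.zero)
next
  case (Suc k)
  from packs.Suc[OF Suc assms] show ?case
    by (simp add: algebra_simps)
qed

lemma packs_SucI:
  assumes "packs E k (\<lambda>x. a x - of_bool (x = u) - of_bool (x = v))"
    and "(u, v) \<in> E" "u \<noteq> v" "0 < a u" "0 < a v"
  shows "packs E (Suc k) a"
proof -
  have "a x - of_bool (x = u) - of_bool (x = v) + of_bool (x = u) + of_bool (x = v) = a x" for x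
    using assms(3-5) by (auto simp: of_bool_def)
  then show ?thesis using packs.Suc[OF assms(1,2)] by simp
qed

lemma sum_of_bool_eq:
  assumes "finite D"
  shows "(\<Sum>x\<in>D. of_bool (x = u) :: nat) = of_bool (u \<in> D)"
  using assms by (simp add: of_bool_def)

section \<open>Koenig duality for bipartite graphs with vertex weights\<close>

text \<open>Koenig's theorem for a bipartite graph with vertex weights, by induction on \<open>s\<close>: it suffices to
find an edge between vertices of positive weight whose ends do not lie together in a tight cover
(one of weight exactly \<open>Suc s\<close>), because removing this edge then lowers the weight of every cover to
no less than \<open>s\<close>. Take any vertex \<open>v\<close> of \<open>B\<close> that has a neighbour, both of positive weight. Tight
covers through \<open>v\<close> form a lattice under union on \<open>A\<close> and intersection on \<open>B\<close>; the one with the largest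
trace on \<open>A\<close> misses a neighbour of \<open>v\<close> of positive weight, since otherwise \<open>v\<close> could be
exchanged for vertices of weight \<open>0\<close>, and then every tight cover through \<open>v\<close> misses this neighbour.\<close>

lemma weighted_koenig:
  fixes a :: "'a \<Rightarrow> nat"
  assumes fin: "finite A" "finite B" and disj: "A \<inter> B = {}"
    and E: "E \<subseteq> A \<times> B \<union> B \<times> A" and "sym E"
    and "\<And>D. D \<subseteq> A \<union> B \<Longrightarrow> vertex_cover E D \<Longrightarrow> s \<le> sum a D"
  shows "packs E s a"
  using assms(6)
proof (induction s arbitrary: a)
  case 0
  show ?case by (rule packs.zero)
next
  case (Suc s)
  note covers = Suc.prems
  let ?V = "A \<union> B"
  have finD: "finite D" if "D \<subseteq> ?V" for D
    using that fin finite_subset by blast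
  \<comment> \<open>If no edge joined two vertices of positive weight, the vertices of weight 0 would be a cover.\<close>
  define Z where "Z = {x \<in> ?V. a x = 0}"
  have Z: "Z \<subseteq> ?V" "sum a Z = 0" unfolding Z_def by auto
  have "\<not> vertex_cover E Z"
    using covers[OF Z(1)] Z(2) by auto
  then obtain x y where "(x, y) \<in> E" "x \<notin> Z" "y \<notin> Z"
    unfolding vertex_cover_def by blast
  then have "\<exists>v u. (v, u) \<in> E \<and> v \<in> B \<and> u \<in> A \<and> 0 < a v \<and> 0 < a u"
    using subsetD[OF E, of "(x, y)"] symD[OF \<open>sym E\<close>, of x y] E unfolding Z_def by auto
  then obtain v u0 where v: "v \<in> B" "0 < a v" and u0: "(v, u0) \<in> E" "u0 \<in> A" "0 < a u0"
    by blast
  define T where "T = {D. D \<subseteq> ?V \<and> vertex_cover E D \<and> sum a D = Suc s \<and> v \<in> D}"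
  have "\<exists>u. (v, u) \<in> E \<and> 0 < a u \<and> (\<forall>D\<in>T. u \<notin> D)"
  proof (cases "T = {}")
    case True
    then show ?thesis using u0 by blast
  next
    case False
    then obtain D0 where "D0 \<in> T" by blast
    moreover have "\<forall>D. D \<in> T \<longrightarrow> card (D \<inter> A) < Suc (card A)"
      using fin by (simp add: card_mono less_Suc_eq_le)
    ultimately obtain D' where D': "D' \<in> T" and max: "\<And>D. D \<in> T \<Longrightarrow> card (D \<inter> A) \<le> card (D' \<inter> A)"
      using ex_has_greatest_nat[of "\<lambda>D. D \<in> T" D0 "\<lambda>D. card (D \<inter> A)" "Suc (card A)"] by blast
    have D'T: "D' \<subseteq> ?V" "vertex_cover E D'" "sum a D' = Suc s" "v \<in> D'"
      using D' unfolding T_def by auto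
    have sub: "D \<inter> A \<subseteq> D'" if "D \<in> T" for D
    proof -
      have DT: "D \<subseteq> ?V" "vertex_cover E D" "sum a D = Suc s" "v \<in> D"
        using that unfolding T_def by auto
      define X where "X = ((D \<union> D') \<inter> A) \<union> ((D \<inter> D') \<inter> B)"
      \<comment> \<open>\<open>X\<close> and \<open>Y\<close> are covers with the same total weight as \<open>D\<close> and \<open>D'\<close>, so both are tight.\<close>
      define Y where "Y = ((D \<inter> D') \<inter> A) \<union> ((D \<union> D') \<inter> B)"
      have XY: "X \<subseteq> ?V" "Y \<subseteq> ?V" unfolding X_def Y_def by auto
      have cov: "vertex_cover E X" "vertex_cover E Y"
        using DT(2) D'T(2) E disj unfolding vertex_cover_def X_def Y_def by fast+
      have "X \<union> Y = D \<union> D'" "X \<inter> Y = D \<inter> D'"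
        unfolding X_def Y_def using disj DT(1) D'T(1) by auto
      then have "sum a X + sum a Y = sum a D + sum a D'"
        using sum.union_inter[of X Y a] sum.union_inter[of D D' a] XY DT(1) D'T(1) finD by metis
      then have "sum a X = Suc s"
        using covers[OF XY(1) cov(1)] covers[OF XY(2) cov(2)] DT(3) D'T(3) by linarith
      moreover have "v \<in> X" using v DT(4) D'T(4) unfolding X_def by auto
      ultimately have "X \<in> T" unfolding T_def using XY cov by simp
      then have "card (X \<inter> A) \<le> card (D' \<inter> A)" by (rule max)
      moreover have "D' \<inter> A \<subseteq> X \<inter> A" unfolding X_def by auto
      ultimately have "X \<inter> A = D' \<inter> A"
        using fin by (metis card_seteq finite_Int)
      then show ?thesis unfolding X_def by auto
    qed
    have "\<exists>u. (v, u) \<in> E \<and> 0 < a u \<and> u \<notin> D'"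
    proof (rule ccontr)
      assume "\<not> ?thesis"
      then have nb: "a u = 0 \<or> u \<in> D'" if "(v, u) \<in> E" for u
        using that by auto
      define X where "X = (D' - {v}) \<union> Z"
      have nbX: "u \<in> X" if "(v, u) \<in> E" for u
        using nb[OF that] that E v disj unfolding X_def Z_def by auto
      have "vertex_cover E X"
        unfolding vertex_cover_def
      proof safe
        fix x y assume xy: "(x, y) \<in> E" "y \<notin> X"
        have yx: "(y, x) \<in> E" using xy \<open>sym E\<close> by (auto dest: symD)
        have "x \<noteq> v" using nbX xy by blast
        show "x \<in> X"
        proof (cases "y = v")
          case True
          then show ?thesis using nbX yx by blast
        next
          case False
          then have "y \<notin> D'" using xy(2) unfolding X_def by blast
          then have "x \<in> D'" using D'T(2) xy(1) unfolding vertex_cover_def by blast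
          then show ?thesis using \<open>x \<noteq> v\<close> unfolding X_def by blast
        qed
      qed
      moreover have XV: "X \<subseteq> ?V" using D'T(1) Z unfolding X_def by auto
      ultimately have "Suc s \<le> sum a X" by (intro covers)
      also have "sum a X \<le> sum a (D' - {v}) + sum a Z"
        unfolding X_def using sum.union_inter[of "D' - {v}" Z a] finD[OF D'T(1)] finD[OF Z(1)] by simp
      also have "\<dots> < sum a D'"
        using sum.remove[of D' v a] finD[OF D'T(1)] D'T(4) v(2) Z(2) by simp
      finally show False using D'T(3) by simp
    qed
    then obtain u where u: "(v, u) \<in> E" "0 < a u" "u \<notin> D'" by blast
    then have "u \<in> A" using E v disj by auto
    then show ?thesis using u sub by blast
  qed
  then obtain u where u: "(v, u) \<in> E" "0 < a u" and noT: "\<And>D. D \<in> T \<Longrightarrow> u \<notin> D" by blast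
  have "u \<noteq> v" using u(1) E disj by auto
  define a' where "a' = (\<lambda>x. a x - of_bool (x = v) - of_bool (x = u))"
  have a: "a x = a' x + of_bool (x = v) + of_bool (x = u)" for x
    using u(2) v(2) \<open>u \<noteq> v\<close> unfolding a'_def by (auto simp: of_bool_def)
  have "packs E s a'"
  proof (rule Suc.IH)
    fix D assume D: "D \<subseteq> ?V" "vertex_cover E D"
    have eq: "sum a D = sum a' D + of_bool (v \<in> D) + of_bool (u \<in> D)"
      unfolding a sum.distrib using finD[OF D(1)] by (simp add: sum_of_bool_eq)
    have "Suc s \<le> sum a D" by (rule covers[OF D])
    moreover have "\<not> (v \<in> D \<and> u \<in> D)" if "sum a D = Suc s"
      using noT[of D] that D unfolding T_def by blast
    ultimately show "s \<le> sum a' D" using eq by (cases "v \<in> D"; cases "u \<in> D"; fastforce)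
  qed
  then show ?case
    unfolding a'_def by (rule packs_SucI) (use u v \<open>u \<noteq> v\<close> in auto)
qed

section \<open>Odd closed walks and induced odd cycles\<close>

lemma sym_relpow:
  assumes "sym E" "(x, y) \<in> E ^^ n"
  shows "(y, x) \<in> E ^^ n"
  using assms(2)
proof (induction n arbitrary: y)
  case (Suc n)
  then obtain z where "(x, z) \<in> E ^^ n" "(z, y) \<in> E" by auto
  then show ?case using Suc.IH symD[OF assms(1)] relpow_Suc_I2 by metis
qed simp

lemma relpow_add_I: "(x, y) \<in> E ^^ m \<Longrightarrow> (y, z) \<in> E ^^ n \<Longrightarrow> (x, z) \<in> E ^^ (m + n)"
  by (auto simp: relpow_add)

text \<open>Choose a root in every component and put a vertex on the side given by the parity of a walk from its
root. An edge inside one side would close up to an odd walk through the root.\<close>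

lemma bipartition_if_no_odd_closed_walk:
  assumes "sym E" and odd: "\<And>v L. odd L \<Longrightarrow> (v, v) \<notin> E ^^ L" and "E \<subseteq> V \<times> V"
  obtains A B where "A \<inter> B = {}" "A \<union> B = V" "E \<subseteq> A \<times> B \<union> B \<times> A"
proof -
  \<comment> \<open>The choice depends only on the set of vertices connected to \<open>v\<close>, so adjacent vertices share it.\<close>
  define r where "r v = (SOME u. (u, v) \<in> E\<^sup>*)" for v
  have r: "(r v, v) \<in> E\<^sup>*" for v
    unfolding r_def by (rule someI[of "\<lambda>u. (u, v) \<in> E\<^sup>*" v]) simp
  have r_eq: "r x = r y" if "(x, y) \<in> E" for x y
  proof -
    have "(y, x) \<in> E" using that \<open>sym E\<close> by (auto dest: symD)
    then have "(u, x) \<in> E\<^sup>* \<longleftrightarrow> (u, y) \<in> E\<^sup>*" for u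
      using that by (meson rtrancl.rtrancl_into_rtrancl)
    then show ?thesis unfolding r_def by simp
  qed
  define A where "A = {v \<in> V. \<exists>L. even L \<and> (r v, v) \<in> E ^^ L}"
  have "x \<in> A \<longleftrightarrow> y \<notin> A" if xy: "(x, y) \<in> E" for x y
  proof -
    have V: "x \<in> V" "y \<in> V" using xy assms(3) by auto
    have xy1: "(x, y) \<in> E ^^ 1" using xy by simp
    have "\<not> (x \<in> A \<and> y \<in> A)"
    proof
      assume "x \<in> A \<and> y \<in> A"
      then obtain L M where L: "even L" "(r x, x) \<in> E ^^ L" and M: "even M" "(r y, y) \<in> E ^^ M"
        unfolding A_def by auto
      have "(r x, r x) \<in> E ^^ (L + (1 + M))"
        using L(2) xy1 sym_relpow[OF \<open>sym E\<close> M(2)] r_eq[OF xy] by (intro relpow_add_I) auto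
      then show False using odd[of "L + (1 + M)"] L(1) M(1) by simp
    qed
    moreover have "y \<in> A" if "x \<notin> A"
    proof -
      obtain L where L: "(r x, x) \<in> E ^^ L" using r[of x] by (meson rtrancl_imp_relpow)
      then have "\<not> even L" using that V unfolding A_def by blast
      moreover have "(r y, y) \<in> E ^^ (L + 1)"
        using relpow_add_I[OF L xy1] r_eq[OF xy] by simp
      ultimately show ?thesis unfolding A_def using V
        by (auto intro!: exI[of _ "L + 1"] simp del: relpow.simps)
    qed
    ultimately show ?thesis by blast
  qed
  then have "E \<subseteq> A \<times> (V - A) \<union> (V - A) \<times> A" using assms(3) by auto
  moreover have "A \<subseteq> V" unfolding A_def by auto
  ultimately show ?thesis by (intro that[of A "V - A"]) auto
qed

definition induced_cycle :: "'a rel \<Rightarrow> 'a list \<Rightarrow> bool" where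
  "induced_cycle E vs \<longleftrightarrow> distinct vs \<and> 3 \<le> length vs \<and>
     (\<forall>i<length vs. \<forall>j<length vs.
        (vs ! i, vs ! j) \<in> E \<longleftrightarrow> j = Suc i mod length vs \<or> i = Suc j mod length vs)"

text \<open>In a shortest odd closed walk, a repeated vertex or a chord splits the walk into two closed walks
of which one is odd and shorter: their lengths add up to \<open>n\<close> in the first case and to \<open>n + 2\<close> in
the second.\<close>

lemma induced_odd_cycle_if_odd_closed_walk:
  assumes "sym E" "irrefl E" "odd L" "(v, v) \<in> E ^^ L"
  obtains vs where "induced_cycle E vs" "odd (length vs)" "set vs \<subseteq> Domain E"
proof -
  define n where "n = (LEAST L. odd L \<and> (\<exists>v. (v, v) \<in> E ^^ L))"
  have n: "odd n" "\<exists>v. (v, v) \<in> E ^^ n"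
    using LeastI[of "\<lambda>L. odd L \<and> (\<exists>v. (v, v) \<in> E ^^ L)" L] assms unfolding n_def by blast+
  have min: "n \<le> m" if "odd m" "(x, x) \<in> E ^^ m" for m x
    unfolding n_def using that by (intro Least_le) blast
  from n(2) obtain f where f0n: "f 0 = f n" and f: "\<And>i. i < n \<Longrightarrow> (f i, f (Suc i)) \<in> E"
    unfolding relpow_fun_conv by metis
  have path: "(f i, f j) \<in> E ^^ (j - i)" if "i \<le> j" "j \<le> n" for i j
    unfolding relpow_fun_conv
    by (rule exI[of _ "\<lambda>l. f (i + l)"]) (use that f in auto)
  have outer: "(f j, f i) \<in> E ^^ (n - j + i)" if "i \<le> j" "j \<le> n" for i j
  proof (rule relpow_add_I)
    show "(f j, f 0) \<in> E ^^ (n - j)" unfolding f0n using path[of j n] that by simp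
    show "(f 0, f i) \<in> E ^^ i" using path[of 0 i] that by simp
  qed
  have "n \<noteq> 1" using n(2) \<open>irrefl E\<close> by (auto simp: irrefl_def)
  then have n3: "3 \<le> n" using n(1) by (cases n) (auto elim!: oddE)
  have inj: "f i \<noteq> f j" if "i < j" "j < n" for i j
  proof
    assume eq: "f i = f j"
    have "(f i, f i) \<in> E ^^ (j - i)" "(f i, f i) \<in> E ^^ (n - j + i)"
      using path[of i j] outer[of i j] that eq by auto
    then have "even (j - i)" "even (n - j + i)"
      using min[of "j - i" "f i"] min[of "n - j + i" "f i"] that by fastforce+
    then have "even (j - i + (n - j + i))" by simp
    also have "j - i + (n - j + i) = n" using that by simp
    finally show False using n(1) by simp
  qed
  have chord: "j = Suc i \<or> i = 0 \<and> Suc j = n" if "i < j" "j < n" "(f i, f j) \<in> E" for i j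
  proof (rule ccontr)
    assume neg: "\<not> ?thesis"
    have e: "(f j, f i) \<in> E ^^ 1" "(f i, f j) \<in> E ^^ 1"
      using that(3) \<open>sym E\<close> by (auto dest: symD)
    have "(f i, f i) \<in> E ^^ (j - i + 1)"
      using that by (intro relpow_add_I[OF path e(1)]) auto
    moreover have "(f j, f j) \<in> E ^^ (n - j + i + 1)"
      using that by (intro relpow_add_I[OF outer e(2)]) auto
    ultimately have "even (j - i + 1)" "even (n - j + i + 1)"
      using min[of "j - i + 1" "f i"] min[of "n - j + i + 1" "f j"] that neg by fastforce+
    then have "even (j - i + 1 + (n - j + i + 1))" by simp
    also have "j - i + 1 + (n - j + i + 1) = n + 2" using that by simp
    finally show False using n(1) by simp
  qed
  define vs where "vs = map f [0..<n]"
  have len: "length vs = n" and nth: "\<And>i. i < n \<Longrightarrow> vs ! i = f i" unfolding vs_def by auto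
  have dist: "distinct vs"
    unfolding vs_def distinct_map inj_on_def using inj by (auto, metis linorder_neqE_nat)
  have succ: "(f i, f (Suc i mod n)) \<in> E" if "i < n" for i
    using f[OF that] f0n that by (cases "Suc i = n") auto
  have "induced_cycle E vs"
    unfolding induced_cycle_def len
  proof (intro conjI dist n3 allI impI)
    fix i j assume ij: "i < n" "j < n"
    show "(vs ! i, vs ! j) \<in> E \<longleftrightarrow> j = Suc i mod n \<or> i = Suc j mod n"
      unfolding nth[OF ij(1)] nth[OF ij(2)]
    proof
      assume E: "(f i, f j) \<in> E"
      then have E': "(f j, f i) \<in> E" using \<open>sym E\<close> by (auto dest: symD)
      have "i \<noteq> j" using E \<open>irrefl E\<close> by (auto simp: irrefl_def)
      then consider "i < j" | "j < i" by linarith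
      then show "j = Suc i mod n \<or> i = Suc j mod n"
      proof cases
        case 1
        then show ?thesis using chord[OF 1 ij(2) E] ij by auto
      next
        case 2
        then show ?thesis using chord[OF 2 ij(1) E'] ij by auto
      qed
    next
      assume "j = Suc i mod n \<or> i = Suc j mod n"
      then show "(f i, f j) \<in> E"
        using succ[OF ij(1)] succ[OF ij(2)] \<open>sym E\<close> by (auto dest: symD)
    qed
  qed
  moreover have "set vs \<subseteq> Domain E"
    unfolding vs_def using DomainI[OF f] by auto
  ultimately show ?thesis using that n(1) len by blast
qed

text \<open>Every second edge of a path on distinct vertices is used.\<close>

lemma packs_path:
  assumes "successively (\<lambda>x y. (x, y) \<in> E) vs" "distinct vs" "2 * r \<le> length vs"
    and "\<And>x. x \<in> set vs \<Longrightarrow> 0 < a x"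
  shows "packs E r a"
  using assms
proof (induction r arbitrary: vs a)
  case 0
  show ?case by (rule packs.zero)
next
  case (Suc r)
  then obtain x y zs where vs: "vs = x # y # zs"
    by (metis Suc_le_length_iff add_2_eq_Suc mult_Suc_right)
  have xy: "(x, y) \<in> E" "x \<noteq> y" "0 < a x" "0 < a y"
    using Suc.prems unfolding vs by auto
  have "successively (\<lambda>x y. (x, y) \<in> E) zs"
    using Suc.prems(1) unfolding vs by (cases zs) auto
  then have "packs E r (\<lambda>z. a z - of_bool (z = x) - of_bool (z = y))"
    by (rule Suc.IH) (use Suc.prems vs in auto)
  then show ?case by (rule packs_SucI) (use xy in auto)
qed

lemma induced_cycle_edge:
  assumes "induced_cycle E vs" "i < length vs"
  shows "(vs ! i, vs ! (Suc i mod length vs)) \<in> E"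
proof -
  have "Suc i mod length vs < length vs" using assms(2) by (intro mod_less_divisor) auto
  then show ?thesis using assms unfolding induced_cycle_def by blast
qed

lemma successively_induced_cycle:
  assumes "induced_cycle E vs"
  shows "successively (\<lambda>x y. (x, y) \<in> E) vs"
  unfolding successively_conv_nth
proof (intro allI impI)
  fix i assume "Suc i < length vs"
  then show "(vs ! i, vs ! Suc i) \<in> E" using induced_cycle_edge[OF assms, of i] by simp
qed

section \<open>Covers, packings and short odd cycles\<close>

text \<open>The duality between covers and packings fails only because of short odd cycles. If the graph
induced on the support of \<open>a\<close> is bipartite, Koenig's theorem applies. Otherwise it has an induced cycle
on \<open>2 * r + 1\<close> vertices, in which \<open>r\<close> disjoint edges fit under \<open>a\<close>; hence \<open>r < s\<close>, and the bound
on the length comes for free.\<close>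

lemma packing_or_induced_odd_cycle:
  fixes a :: "'a \<Rightarrow> nat"
  assumes fin: "finite V" and E: "E \<subseteq> V \<times> V" "sym E" "irrefl E"
    and covers: "\<And>D. D \<subseteq> V \<Longrightarrow> vertex_cover E D \<Longrightarrow> s \<le> sum a D"
    and npacks: "\<not> packs E s a"
  obtains vs where "induced_cycle E vs" "odd (length vs)" "length vs \<le> 2 * s - 1"
    "set vs \<subseteq> {v \<in> V. 0 < a v}"
proof -
  define W where "W = {v \<in> V. 0 < a v}"
  define E' where "E' = E \<inter> W \<times> W"
  have E': "sym E'" "irrefl E'" "E' \<subseteq> W \<times> W"
    using E unfolding E'_def sym_def irrefl_def by auto
  have pE': "packs E k b" if "packs E' k b" for k b
    using that by induction (auto simp: E'_def intro: packs.intros)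
  have "\<exists>v L. odd L \<and> (v, v) \<in> E' ^^ L"
  proof (rule ccontr)
    assume "\<not> ?thesis"
    then obtain A B where AB: "A \<inter> B = {}" "A \<union> B = W" "E' \<subseteq> A \<times> B \<union> B \<times> A"
      using bipartition_if_no_odd_closed_walk[OF E'(1) _ E'(3)] by metis
    have "finite W" using fin unfolding W_def by simp
    then have finAB: "finite A" "finite B" using AB(2) by (metis finite_Un)+
    have "packs E' s a"
    proof (rule weighted_koenig[OF finAB AB(1) AB(3) E'(1)])
      fix D assume D: "D \<subseteq> A \<union> B" "vertex_cover E' D"
      have "vertex_cover E (D \<union> (V - W))"
        using D(2) E(1) unfolding vertex_cover_def E'_def by fast
      then have "s \<le> sum a (D \<union> (V - W))"
        using D(1) AB(2) W_def by (intro covers) auto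
      also have "\<dots> = sum a D"
        using fin D(1) AB(2) finite_subset[OF D(1)] finAB
        by (intro sum.mono_neutral_right) (auto simp: W_def)
      finally show "s \<le> sum a D" .
    qed
    then show False using pE' npacks by blast
  qed
  then obtain v L where "odd L" "(v, v) \<in> E' ^^ L" by blast
  from induced_odd_cycle_if_odd_closed_walk[OF E'(1,2) this]
  obtain vs where vs: "induced_cycle E' vs" "odd (length vs)" "set vs \<subseteq> Domain E'" .
  have sW: "set vs \<subseteq> W" using vs(3) E'(3) by auto
  have cyc: "induced_cycle E vs"
    using vs(1) sW unfolding induced_cycle_def E'_def by (auto simp: subset_iff)
  from vs(2) obtain r where r: "length vs = 2 * r + 1" by (elim oddE)
  have "packs E r a"
    by (rule packs_path[OF successively_induced_cycle[OF cyc]])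
      (use cyc sW r in \<open>auto simp: induced_cycle_def W_def\<close>)
  have "r < s"
  proof (rule ccontr)
    assume "\<not> r < s"
    then show False using packs_antimono[OF \<open>packs E r a\<close>] npacks by simp
  qed
  then show ?thesis using that[OF cyc vs(2)] r sW unfolding W_def by auto
qed
text \<open>Each unit of weight on \<open>N\<close> is matched with a unit of weight on a neighbour in \<open>F\<close>; no vertex of \<open>F\<close>
is asked for more than the total.\<close>

lemma packs_star:
  assumes "finite N" and "\<And>y. y \<in> N \<Longrightarrow> \<exists>z\<in>F. (y, z) \<in> E"
  shows "packs E (sum c N) (\<lambda>x. (if x \<in> N then c x else 0) + (if x \<in> F then sum c N else 0))"
  using assms
proof (induction N rule: finite_induct)
  case empty
  show ?case by (simp add: packs.zero)
next
  case (insert y N)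
  obtain z where z: "z \<in> F" "(y, z) \<in> E" using insert.prems by blast
  have "packs E (sum c N) (\<lambda>x. (if x \<in> N then c x else 0) + (if x \<in> F then sum c N else 0))"
    using insert by auto
  from packs_add[OF packs_repeated_edge[OF z(2), of "c y"] this]
  show ?case
    unfolding sum.insert[OF insert.hyps]
    by (rule packs_mono) (use z(1) insert.hyps in auto)
qed

lemma truncate_weight:
  fixes b :: "'a \<Rightarrow> nat"
  assumes "finite N" "k \<le> sum b N"
  obtains c where "\<And>x. c x \<le> b x" "sum c N = k"
proof -
  have "\<exists>c. (\<forall>x. c x \<le> b x) \<and> sum c N = k"
    using assms(2)
  proof (induction k)
    case 0
    show ?case by (rule exI[of _ "\<lambda>_. 0"]) simp
  next
    case (Suc k)
    then obtain c where c: "\<And>x. c x \<le> b x" "sum c N = k" by auto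
    then obtain x where x: "x \<in> N" "c x < b x"
      using Suc.prems sum_mono[of N b c] by (meson not_less not_less_eq_eq)
    have "sum (c(x := Suc (c x))) N = Suc (sum c N)"
      using x(1) assms(1) by (simp add: sum.remove[of N x])
    then show ?case
      using c x by (intro exI[of _ "c(x := Suc (c x))"]) auto
  qed
  then show ?thesis using that by blast
qed

text \<open>The combinatorial core of the upper bound. Weight \<open>k\<close> on each vertex of \<open>F\<close> acts as an unlimited
supply, so that \<open>F\<close> cannot contain an edge, and the weight on the set \<open>N\<close> of neighbours of \<open>F\<close> can
be used up completely by edges into \<open>F\<close>. What is left to pack is \<open>s = k - a(N)\<close> edges on the vertices
outside \<open>N\<close> and \<open>F\<close>. A cover of the remaining graph together with \<open>N\<close> covers everything, so that the
remaining graph satisfies the hypothesis of \<open>packing_or_induced_odd_cycle\<close> for \<open>s\<close>.\<close>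

lemma induced_odd_cycle_away_from:
  fixes a :: "'a \<Rightarrow> nat"
  assumes fin: "finite V" and E: "E \<subseteq> V \<times> V" "sym E" "irrefl E"
    and F: "F \<subseteq> V"
    and covers: "\<And>D. D \<subseteq> V \<Longrightarrow> vertex_cover E D \<Longrightarrow> k \<le> sum a D"
    and npacks: "\<not> packs E k (\<lambda>x. a x + (if x \<in> F then k else 0))"
  obtains vs where "induced_cycle E vs" "odd (length vs)" "length vs \<le> 2 * k - 1" "set vs \<subseteq> V"
    "set vs \<inter> F = {}" "E \<inter> set vs \<times> F = {}" "E \<inter> F \<times> F = {}"
proof -
  have indep: "E \<inter> F \<times> F = {}"
  proof (rule ccontr)
    assume "\<not> ?thesis"
    then obtain u v where uv: "(u, v) \<in> E" "u \<in> F" "v \<in> F" by blast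
    then have "u \<noteq> v" using E(3) by (auto simp: irrefl_def)
    have "packs E k (\<lambda>x. a x + (if x \<in> F then k else 0))"
      by (rule packs_mono[OF packs_repeated_edge[OF uv(1)]]) (use uv \<open>u \<noteq> v\<close> in auto)
    then show False using npacks by blast
  qed
  define N where "N = {y \<in> V. \<exists>z\<in>F. (y, z) \<in> E}"
  have N: "N \<subseteq> V" "N \<inter> F = {}" using indep unfolding N_def by auto
  have finN: "finite N" using N fin finite_subset by blast
  define V' where "V' = V - N - F"
  define E' where "E' = E \<inter> V' \<times> V'"
  have E': "E' \<subseteq> V' \<times> V'" "sym E'" "irrefl E'"
    using E unfolding E'_def sym_def irrefl_def by auto
  have star: "packs E (sum c N) (\<lambda>x. (if x \<in> N then c x else 0) + (if x \<in> F then sum c N else 0))" for c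
    by (rule packs_star[OF finN]) (simp add: N_def)
  have less: "sum a N < k"
  proof (rule ccontr)
    assume "\<not> sum a N < k"
    then obtain c where c: "\<And>x. c x \<le> a x" "sum c N = k"
      using truncate_weight[OF finN, of k a] by (metis not_less)
    have "packs E k (\<lambda>x. a x + (if x \<in> F then k else 0))"
      by (rule packs_mono[OF star[of c, unfolded c(2)]]) (use c(1) N(2) in auto)
    then show False using npacks by blast
  qed
  define s where "s = k - sum a N"
  have covers': "s \<le> sum a D" if D: "D \<subseteq> V'" "vertex_cover E' D" for D
  proof -
    have "vertex_cover E (D \<union> N)"
      unfolding vertex_cover_def
    proof safe
      fix x y assume xy: "(x, y) \<in> E" "y \<notin> D" "y \<notin> N" "x \<notin> N"
      have V: "x \<in> V" "y \<in> V" and yx: "(y, x) \<in> E"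
        using xy E(1,2) by (auto dest: symD)
      have "x \<notin> F" using xy yx V unfolding N_def by blast
      moreover have "y \<notin> F" using xy V unfolding N_def by blast
      ultimately have "(x, y) \<in> E'"
        using xy V unfolding E'_def V'_def by blast
      then show "x \<in> D" using D(2) xy(2) unfolding vertex_cover_def by blast
    qed
    then have "k \<le> sum a (D \<union> N)"
      using D(1) N(1) unfolding V'_def by (intro covers) auto
    also have "\<dots> = sum a D + sum a N"
      by (rule sum.union_disjoint) (use finN finite_subset[OF _ fin, of D] D(1) V'_def in auto)
    finally show ?thesis unfolding s_def by simp
  qed
  have "\<not> packs E' s (\<lambda>x. if x \<in> V' then a x else 0)"
  proof
    assume "packs E' s (\<lambda>x. if x \<in> V' then a x else 0)"
    then have "packs E s (\<lambda>x. if x \<in> V' then a x else 0)"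
      by induction (auto simp: E'_def intro: packs.intros)
    from packs_add[OF star this, of a]
    have "packs E k (\<lambda>x. (if x \<in> N then a x else 0) + (if x \<in> F then sum a N else 0) +
        (if x \<in> V' then a x else 0))"
      using less unfolding s_def by simp
    then have "packs E k (\<lambda>x. a x + (if x \<in> F then k else 0))"
      by (rule packs_mono) (use less N in \<open>auto simp: V'_def\<close>)
    then show False using npacks by blast
  qed
  moreover have "finite V'" using fin unfolding V'_def by simp
  moreover have "s \<le> (\<Sum>x\<in>D. if x \<in> V' then a x else 0)" if "D \<subseteq> V'" "vertex_cover E' D" for D
  proof -
    have "(\<Sum>x\<in>D. if x \<in> V' then a x else 0) = sum a D"
      by (rule sum.cong) (use that in auto)
    then show ?thesis using covers'[OF that] by simp
  qed
  ultimately obtain vs where vs: "induced_cycle E' vs" "odd (length vs)" "length vs \<le> 2 * s - 1"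
    "set vs \<subseteq> V'"
    using packing_or_induced_odd_cycle[OF _ E', of s] by (smt (verit) mem_Collect_eq subset_iff)
  have "induced_cycle E vs"
    using vs(1,4) unfolding induced_cycle_def E'_def by (auto simp: subset_iff)
  moreover have "length vs \<le> 2 * k - 1" using vs(3) unfolding s_def by simp
  moreover have "E \<inter> set vs \<times> F = {}"
    using vs(4) unfolding V'_def N_def by auto
  moreover have "set vs \<subseteq> V" "set vs \<inter> F = {}" using vs(4) unfolding V'_def by auto
  ultimately show ?thesis using that vs(2) indep by blast
qed

section \<open>The monomial of an odd cycle\<close>

text \<open>Each of the \<open>2 * r + 1\<close> edges of the cycle meets \<open>D\<close>, and each vertex lies on two of them.\<close>

lemma vertex_cover_odd_cycle:
  assumes cyc: "induced_cycle E vs" and "length vs = 2 * r + 1" and D: "vertex_cover E D"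
  shows "r < card (D \<inter> set vs)"
proof -
  let ?n = "length vs"
  define h where "h i = (of_bool (vs ! i \<in> D) :: nat)" for i
  have n: "3 \<le> ?n" and dist: "distinct vs"
    using cyc unfolding induced_cycle_def by auto
  have e: "\<And>i. i < ?n \<Longrightarrow> (vs ! i, vs ! (Suc i mod ?n)) \<in> E"
    by (rule induced_cycle_edge[OF cyc])
  have "(\<Sum>i<?n. h (Suc i mod ?n)) = sum h {..<?n}"
  proof -
    obtain m where m: "?n = Suc m" using n by (cases "?n") auto
    have "(\<Sum>i<m. h (Suc i mod Suc m)) = (\<Sum>i<m. h (Suc i))"
      by (rule sum.cong) auto
    then show ?thesis unfolding m using sum.lessThan_Suc_shift[of h m] by simp
  qed
  moreover have "?n \<le> (\<Sum>i<?n. h i + h (Suc i mod ?n))"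
  proof -
    have "(\<Sum>i<?n. 1) \<le> (\<Sum>i<?n. h i + h (Suc i mod ?n))"
      by (rule sum_mono) (use e D in \<open>fastforce simp: vertex_cover_def h_def\<close>)
    then show ?thesis by simp
  qed
  ultimately have "?n \<le> 2 * sum h {..<?n}" by (simp add: sum.distrib)
  moreover have "sum h {..<?n} = card {i. i < ?n \<and> vs ! i \<in> D}"
    unfolding h_def by (simp add: sum.If_cases of_bool_def Int_def)
  moreover have "card {i. i < ?n \<and> vs ! i \<in> D} = card (D \<inter> set vs)"
  proof (rule bij_betw_same_card[of "(!) vs"])
    show "bij_betw ((!) vs) {i. i < ?n \<and> vs ! i \<in> D} (D \<inter> set vs)"
      unfolding bij_betw_def inj_on_def
      using dist by (auto simp: nth_eq_iff_index_eq in_set_conv_nth)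
  qed
  ultimately show ?thesis using assms(2) by linarith
qed

text \<open>Under a weight supported on \<open>W\<close> and \<open>U\<close>, where no edge joins \<open>U\<close> to either set, all packed edges
have both ends in \<open>W\<close>.\<close>

lemma packs_degree:
  assumes "packs E k g" and "finite W" and "sym E"
    and "\<And>x. 0 < g x \<Longrightarrow> x \<in> W \<union> U" and "E \<inter> U \<times> (W \<union> U) = {}"
  shows "2 * k \<le> sum g W"
  using assms(1,4)
proof induction
  case (zero a)
  show ?case by simp
next
  case (Suc k a u v)
  have "2 * k \<le> sum a W" 
  proof (rule Suc.IH)
    fix x assume "0 < a x"
    then show "x \<in> W \<union> U" using Suc.prems[of x] by simp
  qed
  moreover have "u \<in> W \<union> U" "v \<in> W \<union> U" using Suc.prems[of u] Suc.prems[of v] by auto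
  then have "u \<in> W" "v \<in> W"
    using assms(5) Suc.hyps(2) symD[OF \<open>sym E\<close> Suc.hyps(2)] by auto
  ultimately show ?case using \<open>finite W\<close> by (simp add: sum.distrib sum_of_bool_eq)
qed

text \<open>The witness for the lower bound: the product of the vertices of a cycle with \<open>2 * r + 1\<close> vertices,
times the \<open>(k - r - 1)\<close>-st power of one of its edges. Its total degree is \<open>2 * k - 1\<close>, one less than the
degree of \<open>k\<close> edges.\<close>

definition cycle_weight :: "'a list \<Rightarrow> nat \<Rightarrow> 'a \<Rightarrow> nat" where
  "cycle_weight vs k = (\<lambda>x. of_bool (x \<in> set vs) +
     (k - length vs div 2 - 1) * (of_bool (x = vs ! 0) + of_bool (x = vs ! 1)))"

context
  fixes E :: "'a rel" and vs :: "'a list" and k :: nat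
  assumes E: "sym E" and cyc: "induced_cycle E vs"
    and len: "odd (length vs)" "length vs \<le> 2 * k - 1"
begin

text \<open>A cover has at least \<open>r + 1\<close> vertices on the cycle, at least one of which is an end of the distinguished
edge.\<close>

lemma cycle_weight_vertex_cover:
  assumes "finite D" "vertex_cover E D"
  shows "k \<le> sum (cycle_weight vs k) D"
proof -
  obtain r where r: "length vs = 2 * r + 1" using len(1) by (elim oddE)
  have n3: "3 \<le> length vs" using cyc unfolding induced_cycle_def by blast
  have "(vs ! 0, vs ! (Suc 0 mod length vs)) \<in> E"
    using n3 by (intro induced_cycle_edge[OF cyc]) auto
  then have "(vs ! 0, vs ! 1) \<in> E" using n3 by simp
  then have one: "vs ! 0 \<in> D \<or> vs ! 1 \<in> D" using assms(2) unfolding vertex_cover_def by blast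
  have "k \<le> Suc r + (k - r - 1)" by simp
  also have "\<dots> \<le> card (D \<inter> set vs) + (k - r - 1) * (of_bool (vs ! 0 \<in> D) + of_bool (vs ! 1 \<in> D))"
    using vertex_cover_odd_cycle[OF cyc r assms(2)] one by (intro add_mono) auto
  also have "\<dots> = sum (cycle_weight vs k) D"
    unfolding cycle_weight_def r sum.distrib sum_distrib_left[symmetric]
    using assms(1) by (simp add: sum_of_bool_eq of_bool_def sum.If_cases Int_def)
  finally show ?thesis .
qed

lemma not_packs_cycle_weight:
  assumes U: "E \<inter> U \<times> (set vs \<union> U) = {}" "U \<inter> set vs = {}" and c: "\<And>x. 0 < c x \<Longrightarrow> x \<in> U"
  shows "\<not> packs E k (\<lambda>x. cycle_weight vs k x + c x)"
proof
  obtain r where r: "length vs = 2 * r + 1" using len(1) by (elim oddE)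
  have n3: "3 \<le> length vs" and dist: "distinct vs"
    using cyc unfolding induced_cycle_def by blast+
  have in_vs: "vs ! 0 \<in> set vs" "vs ! 1 \<in> set vs" using n3 by (auto intro!: nth_mem)
  assume "packs E k (\<lambda>x. cycle_weight vs k x + c x)"
  then have "2 * k \<le> (\<Sum>x\<in>set vs. cycle_weight vs k x + c x)"
  proof (rule packs_degree[OF _ _ E _ U(1)])
    fix x assume "0 < cycle_weight vs k x + c x"
    then show "x \<in> set vs \<union> U"
      using c[of x] in_vs unfolding cycle_weight_def by (auto split: if_splits simp: of_bool_def)
  qed simp
  also have "\<dots> = sum (cycle_weight vs k) (set vs)"
    by (rule sum.cong) (use c U(2) in fastforce)+
  also have "\<dots> = length vs + 2 * (k - r - 1)"
    unfolding cycle_weight_def r sum.distrib sum_distrib_left[symmetric]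
    using in_vs dist by (simp add: sum_of_bool_eq distinct_card r)
  also have "\<dots> < 2 * k" using r len(2) n3 by simp
  finally show False by simp
qed

end

section \<open>Prime chains in quotient rings\<close>

lemma (in ring) coset_mem_image_ideal_iff:
  assumes J: "ideal J R" and P: "ideal P R" "J \<subseteq> P" and a: "a \<in> carrier R"
  shows "J +> a \<in> (+>) J ` P \<longleftrightarrow> a \<in> P"
proof -
  have id: "ideal ((+>) J ` P) (R Quot J)"
    using ring_ideal_imp_quot_ideal[OF J P(1)] .
  have "(+>) J ` P \<subseteq> carrier (R Quot J)"
    using additive_subgroup.a_subset[OF ideal.axioms(1)[OF id]] .
  moreover have "\<Union> ((+>) J ` P) = P"
    using ideal_incl_iff[OF J P(1)] P(2) by auto
  ultimately show ?thesis
    using canonical_proj_vimage_mem_iff[OF J _ a] by metis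
qed

lemma (in cring) primeideal_quot:
  assumes J: "ideal J R" and P: "primeideal P R" "J \<subseteq> P"
  shows "primeideal ((+>) J ` P) (R Quot J)"
proof -
  interpret P: primeideal P R by fact
  interpret J: ideal J R by fact
  have carr: "carrier (R Quot J) = (+>) J ` carrier R"
    unfolding FactRing_def A_RCOSETS_def' by auto
  note iff = coset_mem_image_ideal_iff[OF J P.is_ideal P(2)]
  show ?thesis
  proof (rule primeidealI)
    show "ideal ((+>) J ` P) (R Quot J)" by (rule ring_ideal_imp_quot_ideal[OF J P.is_ideal])
    show "cring (R Quot J)" by (rule J.quotient_is_cring[OF is_cring])
    show "carrier (R Quot J) \<noteq> (+>) J ` P"
      using iff[OF one_closed] P.I_notcarr P.one_imp_carrier unfolding carr by auto
    fix X Y assume "X \<in> carrier (R Quot J)" "Y \<in> carrier (R Quot J)"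
      and XY: "X \<otimes>\<^bsub>R Quot J\<^esub> Y \<in> (+>) J ` P"
    then obtain a b where ab: "a \<in> carrier R" "X = J +> a" "b \<in> carrier R" "Y = J +> b"
      unfolding carr by auto
    have "X \<otimes>\<^bsub>R Quot J\<^esub> Y = J +> (a \<otimes> b)"
      unfolding FactRing_def using ab by (simp add: J.rcoset_mult_add)
    then have "a \<otimes> b \<in> P" using XY ab iff by simp
    then show "X \<in> (+>) J ` P \<or> Y \<in> (+>) J ` P" using P.I_prime ab iff by blast
  qed
qed

text \<open>Taking images and preimages under the canonical projection identifies chains of primes in the
quotient ring with chains of primes of \<open>R\<close> above \<open>J\<close>.\<close>

lemma (in cring) krull_dim_quot:
  assumes J: "ideal J R"
  shows "krull_dim (R Quot J) =
    Sup {ereal (real d) | d P. (\<forall>i\<le>d. primeideal (P i) R) \<and> J \<subseteq> P 0 \<and> (\<forall>i<d. P i \<subset> P (Suc i))}"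
proof -
  interpret J: ideal J R by fact
  have carr: "carrier (R Quot J) = (+>) J ` carrier R"
    unfolding FactRing_def A_RCOSETS_def' by auto
  have "(\<exists>P. (\<forall>i\<le>d. primeideal (P i) (R Quot J)) \<and> (\<forall>i<d. P i \<subset> P (Suc i))) \<longleftrightarrow>
      (\<exists>P. (\<forall>i\<le>d. primeideal (P i) R) \<and> J \<subseteq> P 0 \<and> (\<forall>i<d. P i \<subset> P (Suc i)))" for d
  proof
    assume "\<exists>P. (\<forall>i\<le>d. primeideal (P i) (R Quot J)) \<and> (\<forall>i<d. P i \<subset> P (Suc i))"
    then obtain P where P: "\<And>i. i \<le> d \<Longrightarrow> primeideal (P i) (R Quot J)" "\<And>i. i < d \<Longrightarrow> P i \<subset> P (Suc i)"
      by blast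
    define Q where "Q i = {r \<in> carrier R. J +> r \<in> P i}" for i
    have "primeideal (Q i) R" if "i \<le> d" for i
      unfolding Q_def
      using ring_hom_ring.primeideal_vimage[OF J.rcos_ring_hom_ring is_cring P(1)[OF that]] .
    moreover have "J \<subseteq> Q 0"
    proof
      fix x assume "x \<in> J"
      then have "J +> x = \<zero>\<^bsub>R Quot J\<^esub>" "x \<in> carrier R"
        unfolding FactRing_def using J.a_rcos_const J.Icarr by auto
      moreover have "\<zero>\<^bsub>R Quot J\<^esub> \<in> P 0"
        using P(1)[of 0] by (simp add: additive_subgroup.zero_closed ideal.axioms(1) primeideal.axioms(1))
      ultimately show "x \<in> Q 0" unfolding Q_def by simp
    qed
    moreover have "Q i \<subset> Q (Suc i)" if "i < d" for i
    proof -
      from P(2)[OF that] obtain X where X: "X \<in> P (Suc i)" "X \<notin> P i" and sub: "P i \<subseteq> P (Suc i)" by blast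
      then have "X \<in> carrier (R Quot J)"
        using P(1)[of "Suc i"] that ideal.Icarr primeideal.axioms(1) by fastforce
      then obtain r where "r \<in> carrier R" "X = J +> r" unfolding carr by auto
      then show ?thesis using X sub unfolding Q_def by blast
    qed
    ultimately show "\<exists>P. (\<forall>i\<le>d. primeideal (P i) R) \<and> J \<subseteq> P 0 \<and> (\<forall>i<d. P i \<subset> P (Suc i))"
      by blast
  next
    assume "\<exists>P. (\<forall>i\<le>d. primeideal (P i) R) \<and> J \<subseteq> P 0 \<and> (\<forall>i<d. P i \<subset> P (Suc i))"
    then obtain P where P: "\<And>i. i \<le> d \<Longrightarrow> primeideal (P i) R" "J \<subseteq> P 0" "\<And>i. i < d \<Longrightarrow> P i \<subset> P (Suc i)"
      by blast
    have JP: "J \<subseteq> P i" if "i \<le> d" for i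
      using that
    proof (induction i)
      case 0
      show ?case by (rule P(2))
    next
      case (Suc i)
      then show ?case using P(3)[of i] by auto
    qed
    define Q where "Q i = (+>) J ` P i" for i
    have "primeideal (Q i) (R Quot J)" if "i \<le> d" for i
      unfolding Q_def by (rule primeideal_quot[OF J P(1)[OF that] JP[OF that]])
    moreover have "Q i \<subset> Q (Suc i)" if "i < d" for i
    proof -
      from P(3)[OF that] obtain x where x: "x \<in> P (Suc i)" "x \<notin> P i" by blast
      have "x \<in> carrier R"
        using P(1)[of "Suc i"] x(1) that by (meson Suc_leI ideal.Icarr primeideal.axioms(1))
      then have "J +> x \<notin> Q i" unfolding Q_def
        using coset_mem_image_ideal_iff[OF J primeideal.axioms(1)[OF P(1)] JP] x(2) that by simp
      then show ?thesis using x(1) P(3)[OF that] unfolding Q_def by blast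
    qed
    ultimately show "\<exists>P. (\<forall>i\<le>d. primeideal (P i) (R Quot J)) \<and> (\<forall>i<d. P i \<subset> P (Suc i))"
      by blast
  qed
  then show ?thesis unfolding krull_dim_def by simp
qed

section \<open>Ideals of the polynomial ring\<close>

lemma mpoly_ring_simps [simp]:
  "mult (mpoly_ring V) = (*)" "one (mpoly_ring V) = 1" "zero (mpoly_ring V) = 0"
  "add (mpoly_ring V) = (+)"
  by (simp_all add: mpoly_ring_def)

lemma mem_mpoly_ring_iff:
  "p \<in> carrier (mpoly_ring V) \<longleftrightarrow> (\<forall>m\<in>Poly_Mapping.keys p. Poly_Mapping.keys m \<subseteq> V)"
  by (simp add: mpoly_ring_def)

lemma mpoly_ring_closed:
  assumes "p \<in> carrier (mpoly_ring V)" "q \<in> carrier (mpoly_ring V)"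
  shows "p + q \<in> carrier (mpoly_ring V)" "p * q \<in> carrier (mpoly_ring V)"
proof -
  interpret cring "mpoly_ring V" by (rule cring_mpoly_ring)
  show "p + q \<in> carrier (mpoly_ring V)" "p * q \<in> carrier (mpoly_ring V)"
    using a_closed[OF assms] m_closed[OF assms] by simp_all
qed

lemma single_mem_mpoly_ring:
  "Poly_Mapping.keys m \<subseteq> V \<Longrightarrow> Poly_Mapping.single m c \<in> carrier (mpoly_ring V)"
  by (simp add: mem_mpoly_ring_iff)

lemma uminus_mpoly: "- p = Poly_Mapping.single 0 (- 1) * (p :: 'k::field mpoly)"
  by (simp add: single_uminus)

lemma mpoly_ideal_closed:
  assumes "ideal P (mpoly_ring V :: 'k::field mpoly ring)"
  shows "P \<subseteq> carrier (mpoly_ring V)" "0 \<in> P"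
    "p \<in> P \<Longrightarrow> q \<in> P \<Longrightarrow> p + q \<in> P"
    "p \<in> P \<Longrightarrow> r \<in> carrier (mpoly_ring V) \<Longrightarrow> r * p \<in> P"
    "p \<in> P \<Longrightarrow> q \<in> P \<Longrightarrow> p - q \<in> P"
proof -
  interpret ideal P "mpoly_ring V" by fact
  show "P \<subseteq> carrier (mpoly_ring V)" by (rule a_subset)
  show "0 \<in> P" using additive_subgroup.zero_closed[OF is_additive_subgroup] by simp
  show add: "p + q \<in> P" if "p \<in> P" "q \<in> P" for p q using additive_subgroup.a_closed[OF is_additive_subgroup that] by simp
  show mult: "r * p \<in> P" if "p \<in> P" "r \<in> carrier (mpoly_ring V)" for p r
    using I_l_closed[OF that] by simp
  show "p - q \<in> P" if "p \<in> P" "q \<in> P"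
  proof -
    have "- q \<in> P"
      unfolding uminus_mpoly by (rule mult[OF that(2) single_mem_mpoly_ring]) simp
    from add[OF that(1) this] show ?thesis by simp
  qed
qed

lemma ideal_mpoly_ringI:
  fixes P :: "'k::field mpoly set"
  assumes sub: "P \<subseteq> carrier (mpoly_ring V)" and zero: "0 \<in> P"
    and add: "\<And>p q. p \<in> P \<Longrightarrow> q \<in> P \<Longrightarrow> p + q \<in> P"
    and mult: "\<And>p r. p \<in> P \<Longrightarrow> r \<in> carrier (mpoly_ring V) \<Longrightarrow> r * p \<in> P"
  shows "ideal P (mpoly_ring V)"
proof -
  interpret cring "mpoly_ring V :: 'k mpoly ring" by (rule cring_mpoly_ring)
  have neg: "- p \<in> P" if "p \<in> P" for p
    unfolding uminus_mpoly by (rule mult[OF that single_mem_mpoly_ring]) simp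
  show ?thesis
  proof (rule idealI)
    show "ring (mpoly_ring V :: 'k mpoly ring)" by (rule ring_axioms)
    show "subgroup P (add_monoid (mpoly_ring V))"
    proof (rule group.subgroupI[OF a_group])
      show "P \<subseteq> carrier (add_monoid (mpoly_ring V))" using sub by simp
      show "P \<noteq> {}" using zero by blast
      show "p \<otimes>\<^bsub>add_monoid (mpoly_ring V)\<^esub> q \<in> P" if "p \<in> P" "q \<in> P" for p q
        using add[OF that] by simp
      fix p assume p: "p \<in> P"
      have "\<ominus>\<^bsub>mpoly_ring V\<^esub> p = - p"
        by (rule minus_equality) (use p neg sub in auto)
      then show "inv\<^bsub>add_monoid (mpoly_ring V)\<^esub> p \<in> P"
        using neg[OF p] by (simp add: a_inv_def)
    qed
    fix p r assume "p \<in> P" "r \<in> carrier (mpoly_ring V :: 'k mpoly ring)"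
    then show "r \<otimes>\<^bsub>mpoly_ring V\<^esub> p \<in> P" "p \<otimes>\<^bsub>mpoly_ring V\<^esub> r \<in> P"
      using mult[of p r] by (simp_all add: mult.commute)
  qed
qed

lemma poly_mapping_sum_singles:
  "(\<Sum>m\<in>Poly_Mapping.keys p. Poly_Mapping.single m (Poly_Mapping.lookup p m)) = p"
  by (rule poly_mapping_eqI)
    (simp add: lookup_sum lookup_single when_def, simp add: in_keys_iff)

lemma sum_mem_closed:
  assumes "0 \<in> X" and "\<And>p q. p \<in> X \<Longrightarrow> q \<in> X \<Longrightarrow> p + q \<in> X"
    and "\<And>x. x \<in> A \<Longrightarrow> f x \<in> X"
  shows "sum f A \<in> X"
  using assms(3) by (induction A rule: infinite_finite_induct) (auto intro: assms)

lemma mem_if_terms_mem: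
  fixes p :: "'a \<Rightarrow>\<^sub>0 'b::comm_monoid_add"
  assumes "0 \<in> X" and "\<And>p q. p \<in> X \<Longrightarrow> q \<in> X \<Longrightarrow> p + q \<in> X"
    and "\<And>m. m \<in> Poly_Mapping.keys p \<Longrightarrow> Poly_Mapping.single m (Poly_Mapping.lookup p m) \<in> X"
  shows "p \<in> X"
proof -
  have "(\<Sum>m\<in>Poly_Mapping.keys p. Poly_Mapping.single m (Poly_Mapping.lookup p m)) \<in> X"
    by (rule sum_mem_closed) (fact assms)+
  then show ?thesis by (simp only: poly_mapping_sum_singles)
qed

lemma single_eq_var_mult:
  assumes "i \<in> Poly_Mapping.keys m"
  shows "Poly_Mapping.single m c =
    Poly_Mapping.single (m - Poly_Mapping.single i 1) c * mpoly_var i"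
proof -
  have "m - Poly_Mapping.single i 1 + Poly_Mapping.single i 1 = m"
    using assms by (intro poly_mapping_eqI)
      (auto simp: lookup_add lookup_minus lookup_single when_def in_keys_iff)
  then show ?thesis by (simp add: mpoly_var_def mult_single)
qed

lemma keys_minus_nat_subset: "Poly_Mapping.keys (m - m' :: 'a \<Rightarrow>\<^sub>0 nat) \<subseteq> Poly_Mapping.keys m"
  by (auto simp: in_keys_iff lookup_minus)

lemma single_mem_ideal_if_var_mem:
  assumes P: "ideal P (mpoly_ring V)" and "mpoly_var i \<in> P"
    and "i \<in> Poly_Mapping.keys m" "Poly_Mapping.keys m \<subseteq> V"
  shows "Poly_Mapping.single m c \<in> P"
proof -
  have "Poly_Mapping.keys (m - Poly_Mapping.single i 1) \<subseteq> V"
    using keys_minus_nat_subset assms(4) by (rule order_trans)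
  from mpoly_ideal_closed(4)[OF P assms(2) single_mem_mpoly_ring[OF this]]
  show ?thesis unfolding single_eq_var_mult[OF assms(3)] .
qed

text \<open>The part of a polynomial that involves only the variables in \<open>F\<close>, that is, the result of
substituting \<open>0\<close> for all other variables.\<close>

definition restrict_vars :: "nat set \<Rightarrow> 'k::field mpoly \<Rightarrow> 'k mpoly" where
  "restrict_vars F = Poly_Mapping.mapp (\<lambda>m c. if Poly_Mapping.keys m \<subseteq> F then c else 0)"

lemma lookup_restrict_vars:
  "Poly_Mapping.lookup (restrict_vars F p) m =
    (if Poly_Mapping.keys m \<subseteq> F then Poly_Mapping.lookup p m else 0)"
  unfolding restrict_vars_def by (simp add: mapp.rep_eq when_def in_keys_iff)

lemma keys_restrict_vars:
  "Poly_Mapping.keys (restrict_vars F p) = {m \<in> Poly_Mapping.keys p. Poly_Mapping.keys m \<subseteq> F}"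
  by (auto simp: in_keys_iff[of _ p] in_keys_iff[of _ "restrict_vars F p"] lookup_restrict_vars split: if_splits)

lemma keys_diff_restrict_vars:
  "Poly_Mapping.keys (p - restrict_vars F p) = {m \<in> Poly_Mapping.keys p. \<not> Poly_Mapping.keys m \<subseteq> F}"
  by (auto simp: in_keys_iff[of _ p] in_keys_iff[of _ "p - restrict_vars F p"] lookup_minus
      lookup_restrict_vars split: if_splits)

lemma diff_restrict_vars_mem:
  assumes P: "ideal P (mpoly_ring V)" and p: "p \<in> carrier (mpoly_ring V)"
    and F: "\<And>i. i \<in> V - F \<Longrightarrow> mpoly_var i \<in> P"
  shows "p - restrict_vars F p \<in> P"
proof (rule mem_if_terms_mem)
  fix m assume "m \<in> Poly_Mapping.keys (p - restrict_vars F p)"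
  then have m: "m \<in> Poly_Mapping.keys p" "\<not> Poly_Mapping.keys m \<subseteq> F"
    unfolding keys_diff_restrict_vars by auto
  then obtain i where i: "i \<in> Poly_Mapping.keys m" "i \<notin> F" by blast
  have "Poly_Mapping.keys m \<subseteq> V" using m(1) p by (auto simp: mem_mpoly_ring_iff)
  then show "Poly_Mapping.single m (Poly_Mapping.lookup (p - restrict_vars F p) m) \<in> P"
    using single_mem_ideal_if_var_mem[OF P F] i by blast
next
  show "0 \<in> P" by (rule mpoly_ideal_closed(2)[OF P])
  show "q + r \<in> P" if "q \<in> P" "r \<in> P" for q r
    by (rule mpoly_ideal_closed(3)[OF P that])
qed

section \<open>Algebraic dependence and chains of primes\<close>

lemma linear_dependence:
  fixes v :: "'i \<Rightarrow> ('m::comm_monoid_add \<Rightarrow>\<^sub>0 'k::field)"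
  assumes "finite L" "finite M" "card M < card L"
    and "\<And>e. e \<in> L \<Longrightarrow> Poly_Mapping.keys (v e) \<subseteq> M"
  obtains c where "\<exists>e\<in>L. c e \<noteq> 0" "(\<Sum>e\<in>L. Poly_Mapping.single 0 (c e) * v e) = 0"
proof -
  interpret vs: vector_space "\<lambda>(c::'k) (p :: 'm \<Rightarrow>\<^sub>0 'k). Poly_Mapping.single 0 c * p"
    by standard (simp_all add: distrib_left distrib_right single_add mult_single mult.assoc[symmetric])
  show ?thesis
  proof (cases "inj_on v L")
    case False
    then obtain x y where xy: "x \<in> L" "y \<in> L" "x \<noteq> y" "v x = v y" unfolding inj_on_def by blast
    define c :: "'i \<Rightarrow> 'k" where "c e = (if e = x then 1 else if e = y then - 1 else 0)" for e
    have "(\<Sum>e\<in>L. Poly_Mapping.single 0 (c e) * v e) = (\<Sum>e\<in>{x, y}. Poly_Mapping.single 0 (c e) * v e)"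
      by (rule sum.mono_neutral_right) (use assms(1) xy in \<open>auto simp: c_def\<close>)
    also have "\<dots> = 0" using xy by (simp add: c_def vs.scale_minus_left)
    finally have rel: "(\<Sum>e\<in>L. Poly_Mapping.single 0 (c e) * v e) = 0" .
    have "c x \<noteq> 0" by (simp add: c_def)
    then show ?thesis using that[of c] rel xy(1) by blast
  next
    case True
    let ?T = "(\<lambda>m. Poly_Mapping.single m (1::'k)) ` M"
    have "v ` L \<subseteq> vs.span ?T"
    proof safe
      fix e assume e: "e \<in> L"
      show "v e \<in> vs.span ?T"
      proof (rule mem_if_terms_mem)
        fix m assume "m \<in> Poly_Mapping.keys (v e)"
        then have "Poly_Mapping.single m 1 \<in> vs.span ?T"
          using assms(4)[OF e] by (intro vs.span_base) auto
        from vs.span_scale[OF this, of "Poly_Mapping.lookup (v e) m"]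
        show "Poly_Mapping.single m (Poly_Mapping.lookup (v e) m) \<in> vs.span ?T"
          by (simp add: mult_single)
      qed (auto intro: vs.span_zero vs.span_add)
    qed
    moreover have "card ?T < card (v ` L)"
      using assms(3) card_image[OF True] card_image_le[OF assms(2)] by (metis order_le_less_trans)
    ultimately have "vs.dependent (v ` L)"
      using vs.independent_span_bound[of ?T "v ` L"] assms(2) by fastforce
    then obtain u where u: "\<exists>x\<in>v ` L. u x \<noteq> 0" "(\<Sum>x\<in>v ` L. Poly_Mapping.single 0 (u x) * x) = 0"
      unfolding vs.dependent_finite[OF finite_imageI[OF assms(1)]] by blast
    have "(\<Sum>e\<in>L. Poly_Mapping.single 0 ((u \<circ> v) e) * v e) = 0"
      using u(2) unfolding sum.reindex[OF True] by simp
    moreover have "\<exists>e\<in>L. (u \<circ> v) e \<noteq> 0" using u(1) by simp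
    ultimately show ?thesis by (intro that)
  qed
qed

definition monomials_le :: "'a set \<Rightarrow> nat \<Rightarrow> ('a \<Rightarrow>\<^sub>0 nat) set" where
  "monomials_le F B = {m. Poly_Mapping.keys m \<subseteq> F \<and> (\<forall>i. Poly_Mapping.lookup m i \<le> B)}"

lemma monomials_le_mono:
  assumes "B \<le> C"
  shows "monomials_le F B \<subseteq> monomials_le F C"
  unfolding monomials_le_def using le_trans[OF _ assms] by blast

lemma card_monomials_le:
  assumes "finite F"
  shows "finite (monomials_le F B)" "card (monomials_le F B) \<le> Suc B ^ card F"
proof -
  let ?f = "\<lambda>m. restrict (Poly_Mapping.lookup m) F"
  have inj: "inj_on ?f (monomials_le F B)"
  proof (rule inj_onI, rule poly_mapping_eqI)
    fix m m' i assume m: "m \<in> monomials_le F B" "m' \<in> monomials_le F B" and eq: "?f m = ?f m'"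
    show "Poly_Mapping.lookup m i = Poly_Mapping.lookup m' i"
    proof (cases "i \<in> F")
      case True
      then show ?thesis using fun_cong[OF eq, of i] by simp
    next
      case False
      then have "i \<notin> Poly_Mapping.keys m" "i \<notin> Poly_Mapping.keys m'"
        using m unfolding monomials_le_def by auto
      then show ?thesis by (simp add: in_keys_iff)
    qed
  qed
  have sub: "?f ` monomials_le F B \<subseteq> F \<rightarrow>\<^sub>E {..B}"
    by (auto simp: monomials_le_def)
  have fin: "finite (F \<rightarrow>\<^sub>E {..B})" using assms by (intro finite_PiE) auto
  show "finite (monomials_le F B)" using inj_on_finite[OF inj sub fin] .
  have "card (monomials_le F B) \<le> card (F \<rightarrow>\<^sub>E {..B})" using card_inj_on_le[OF inj sub fin] .
  also have "\<dots> = Suc B ^ card F" using assms by (simp add: card_PiE)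
  finally show "card (monomials_le F B) \<le> Suc B ^ card F" .
qed

lemma keys_mult_monomials_le:
  assumes "Poly_Mapping.keys p \<subseteq> monomials_le F B" "Poly_Mapping.keys q \<subseteq> monomials_le F C"
  shows "Poly_Mapping.keys (p * q) \<subseteq> monomials_le F (B + C)"
proof
  fix m assume "m \<in> Poly_Mapping.keys (p * q)"
  then obtain a b where ab: "m = a + b" "a \<in> Poly_Mapping.keys p" "b \<in> Poly_Mapping.keys q"
    using keys_mult[of p q] by blast
  then have "a \<in> monomials_le F B" "b \<in> monomials_le F C" using assms by auto
  then show "m \<in> monomials_le F (B + C)"
    unfolding ab(1) monomials_le_def using keys_add[of a b] by (auto simp: lookup_add intro: add_mono)
qed

lemma keys_power_monomials_le:
  fixes p :: "('a \<Rightarrow>\<^sub>0 nat) \<Rightarrow>\<^sub>0 'k::field"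
  assumes "Poly_Mapping.keys p \<subseteq> monomials_le F B"
  shows "Poly_Mapping.keys (p ^ n) \<subseteq> monomials_le F (n * B)"
proof (induction n)
  case 0
  show ?case by (simp add: monomials_le_def)
next
  case (Suc n)
  show ?case using keys_mult_monomials_le[OF assms Suc] by simp
qed

text \<open>Exponent vectors are lists, so that a relation can be peeled off one variable at a time.\<close>

definition power_product :: "'a::comm_monoid_mult list \<Rightarrow> nat list \<Rightarrow> 'a" where
  "power_product ys e = prod_list (map2 (^) ys e)"

lemma power_product_simps [simp]:
  "power_product [] [] = 1"
  "power_product (y # ys) (j # e) = y ^ j * power_product ys e"
  by (simp_all add: power_product_def)

lemma keys_power_product_monomials_le:
  fixes ys :: "(('a \<Rightarrow>\<^sub>0 nat) \<Rightarrow>\<^sub>0 'k::field) list"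
  assumes "length e = length ys" "set e \<subseteq> {..<N}"
    and "\<And>y. y \<in> set ys \<Longrightarrow> Poly_Mapping.keys y \<subseteq> monomials_le F B"
  shows "Poly_Mapping.keys (power_product ys e) \<subseteq> monomials_le F (length ys * (N * B))"
  using assms
proof (induction e ys rule: list_induct2)
  case Nil
  show ?case by (simp add: monomials_le_def)
next
  case (Cons j e y ys)
  have "Poly_Mapping.keys (y ^ j) \<subseteq> monomials_le F (j * B)"
    using Cons.prems by (intro keys_power_monomials_le) simp
  moreover have "j * B \<le> N * B" using Cons.prems by (intro mult_right_mono) auto
  ultimately have "Poly_Mapping.keys (y ^ j) \<subseteq> monomials_le F (N * B)"
    using monomials_le_mono by blast
  from keys_mult_monomials_le[OF this Cons.IH] Cons.prems show ?case by simp
qed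

text \<open>More polynomials than variables are algebraically dependent. With \<open>l\<close> polynomials and exponents below
\<open>N\<close>, there are \<open>N ^ l\<close> power products, but all of them lie in a space of monomials whose dimension
grows only like \<open>N ^ card F\<close>. For large \<open>N\<close> the power products are linearly dependent.\<close>

lemma algebraic_dependence:
  fixes ys :: "(('a \<Rightarrow>\<^sub>0 nat) \<Rightarrow>\<^sub>0 'k::field) list"
  assumes "finite F" "card F < length ys"
    and ys: "\<And>y m. y \<in> set ys \<Longrightarrow> m \<in> Poly_Mapping.keys y \<Longrightarrow> Poly_Mapping.keys m \<subseteq> F"
  obtains Es c where "finite Es" "Es \<noteq> {}" "\<And>e. e \<in> Es \<Longrightarrow> length e = length ys \<and> c e \<noteq> 0"
    "(\<Sum>e\<in>Es. Poly_Mapping.single 0 (c e) * power_product ys e) = 0"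
proof -
  define l where "l = length ys"
  define X where "X = (\<Union>y\<in>set ys. \<Union>m\<in>Poly_Mapping.keys y. Poly_Mapping.lookup m ` Poly_Mapping.keys m)"
  define B where "B = Max (insert 0 X)"
  have "finite X" unfolding X_def by auto
  then have BX: "x \<le> B" if "x \<in> X" for x unfolding B_def using that by auto
  have keysB: "Poly_Mapping.keys y \<subseteq> monomials_le F B" if y: "y \<in> set ys" for y
  proof
    fix m assume m: "m \<in> Poly_Mapping.keys y"
    have "Poly_Mapping.lookup m i \<le> B" for i
    proof (cases "i \<in> Poly_Mapping.keys m")
      case True
      then show ?thesis using y m by (intro BX) (auto simp: X_def)
    qed (simp add: in_keys_iff)
    then show "m \<in> monomials_le F B" unfolding monomials_le_def using ys[OF y m] by simp
  qed
  \<comment> \<open>These values give \<open>Suc (l * (N * B)) \<le> N * K\<close> and \<open>K ^ card F < N\<close>.\<close>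
  define K where "K = l * B + 1"
  define N where "N = K ^ card F + 1"
  define L where "L = {e. set e \<subseteq> {..<N} \<and> length e = l}"
  have L: "finite L" "card L = N ^ l"
    unfolding L_def using finite_lists_length_eq[of "{..<N}" l] card_lists_length_eq[of "{..<N}" l] by auto
  define M where "M = monomials_le F (l * (N * B))"
  have "card M \<le> Suc (l * (N * B)) ^ card F"
    unfolding M_def by (rule card_monomials_le[OF assms(1)])
  also have "\<dots> \<le> (N * K) ^ card F"
    by (rule power_mono) (auto simp: N_def K_def algebra_simps)
  also have "\<dots> = N ^ card F * K ^ card F" by (simp add: power_mult_distrib)
  also have "\<dots> < N ^ card F * N" by (rule mult_strict_left_mono) (auto simp: N_def)
  also have "\<dots> = N ^ Suc (card F)" by simp
  also have "\<dots> \<le> N ^ l" by (rule power_increasing) (use assms(2) in \<open>auto simp: l_def N_def\<close>)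
  finally have card: "card M < card L" unfolding L(2) .
  have finM: "finite M" unfolding M_def by (rule card_monomials_le[OF assms(1)])
  have keys_pp: "Poly_Mapping.keys (power_product ys e) \<subseteq> M" if "e \<in> L" for e
    using keys_power_product_monomials_le[OF _ _ keysB, where e = e and N = N] that unfolding M_def L_def l_def by auto
  from linear_dependence[OF L(1) finM card, of "power_product ys", OF keys_pp]
  obtain c where c: "\<exists>e\<in>L. c e \<noteq> 0" "(\<Sum>e\<in>L. Poly_Mapping.single 0 (c e) * power_product ys e) = 0"
    by blast
  have "(\<Sum>e\<in>{e \<in> L. c e \<noteq> 0}. Poly_Mapping.single 0 (c e) * power_product ys e) =
      (\<Sum>e\<in>L. Poly_Mapping.single 0 (c e) * power_product ys e)"
    by (rule sum.mono_neutral_left) (use L in auto)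
  then have "(\<Sum>e\<in>{e \<in> L. c e \<noteq> 0}. Poly_Mapping.single 0 (c e) * power_product ys e) = 0"
    using c(2) by simp
  moreover have "finite {e \<in> L. c e \<noteq> 0}" using L(1) by simp
  moreover have "{e \<in> L. c e \<noteq> 0} \<noteq> {}" using c(1) by blast
  moreover have "length e = length ys \<and> c e \<noteq> 0" if "e \<in> {e \<in> L. c e \<noteq> 0}" for e
    using that unfolding L_def l_def by simp
  ultimately show ?thesis using that[of "{e \<in> L. c e \<noteq> 0}" c] by blast
qed

lemma one_mem_mpoly_ring: "1 \<in> carrier (mpoly_ring V)"
  by (simp add: mem_mpoly_ring_iff)

lemma zero_mem_mpoly_ring: "0 \<in> carrier (mpoly_ring V)"
  by (simp add: mem_mpoly_ring_iff)

lemma power_mem_mpoly_ring: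
  "y \<in> carrier (mpoly_ring V) \<Longrightarrow> y ^ m \<in> carrier (mpoly_ring V)"
  by (induction m) (simp_all add: one_mem_mpoly_ring mpoly_ring_closed)

lemma power_product_mem_mpoly_ring:
  assumes "length e = length ys" "\<And>y. y \<in> set ys \<Longrightarrow> y \<in> carrier (mpoly_ring V)"
  shows "power_product ys e \<in> carrier (mpoly_ring V)"
  using assms
proof (induction e ys rule: list_induct2)
  case Nil
  show ?case by (simp add: one_mem_mpoly_ring)
next
  case (Cons j e y ys)
  have "y \<in> carrier (mpoly_ring V)" by (rule Cons.prems) simp
  moreover have "power_product ys e \<in> carrier (mpoly_ring V)"
    by (rule Cons.IH, rule Cons.prems) simp
  ultimately show ?case
    unfolding power_product_simps by (intro mpoly_ring_closed power_mem_mpoly_ring)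
qed

lemma prime_power_mem:
  assumes P: "primeideal P (mpoly_ring V)" and y: "y \<in> carrier (mpoly_ring V)" and "y ^ m \<in> P"
  shows "y \<in> P"
proof -
  interpret P: primeideal P "mpoly_ring V" by fact
  show ?thesis
    using assms(3)
  proof (induction m)
    case 0
    then have "\<one>\<^bsub>mpoly_ring V\<^esub> \<in> P" by simp
    from P.one_imp_carrier[OF this] show ?case using y by (simp only:)
  next
    case (Suc m)
    then have "y \<otimes>\<^bsub>mpoly_ring V\<^esub> y ^ m \<in> P" by simp
    from P.I_prime[OF y power_mem_mpoly_ring[OF y] this] show ?case using Suc.IH by blast
  qed
qed

text \<open>Elements \<open>y\<^sub>i\<close> chosen from successive differences of a chain of primes satisfy no algebraic relation,
not even modulo the first prime. Factor out the smallest power of the first element \<open>y\<close> that occurs: as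
\<open>y\<close> is not in \<open>P 0\<close>, the cofactor is in \<open>P 0\<close>, hence in \<open>P 1\<close>. As \<open>y\<close> is in \<open>P 1\<close>, only the terms
without \<open>y\<close> matter there, and these form a relation of the remaining elements modulo \<open>P 1\<close>. In the
end, a nonzero constant lies in a prime ideal.\<close>

lemma no_relation_along_prime_chain:
  fixes ys :: "'k::field mpoly list"
  assumes "\<And>i. i \<le> length ys \<Longrightarrow> primeideal (P i) (mpoly_ring V)"
    and "\<And>i. i < length ys \<Longrightarrow> P i \<subseteq> P (Suc i)"
    and "\<And>i. i < length ys \<Longrightarrow> ys ! i \<in> P (Suc i) - P i"
    and "finite Es" "Es \<noteq> {}" "\<And>e. e \<in> Es \<Longrightarrow> length e = length ys \<and> c e \<noteq> 0"
    and "(\<Sum>e\<in>Es. Poly_Mapping.single 0 (c e) * power_product ys e) \<in> P 0"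
  shows False
  using assms
proof (induction ys arbitrary: P Es c)
  case Nil
  interpret P0: primeideal "P 0" "mpoly_ring V" using Nil.prems(1) by simp
  have "Es = {[]}" "c [] \<noteq> 0" using Nil.prems(5,6) by auto
  then have "Poly_Mapping.single 0 (inverse (c [])) * Poly_Mapping.single 0 (c []) \<in> P 0"
    using Nil.prems(7) mpoly_ideal_closed(4)[OF P0.is_ideal] by (simp add: single_mem_mpoly_ring)
  then have "\<one>\<^bsub>mpoly_ring V\<^esub> \<in> P 0" using \<open>c [] \<noteq> 0\<close> by (simp add: mult_single)
  from P0.one_imp_carrier[OF this] show False using P0.I_notcarr by blast
next
  case (Cons y ys)
  interpret P0: primeideal "P 0" "mpoly_ring V" using Cons.prems(1)[of 0] by simp
  interpret P1: primeideal "P 1" "mpoly_ring V" using Cons.prems(1)[of 1] by simp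
  note P0c = mpoly_ideal_closed[OF P0.is_ideal] and P1c = mpoly_ideal_closed[OF P1.is_ideal]
  have y: "y \<in> P 1" "y \<notin> P 0" using Cons.prems(3)[of 0] by auto
  have P01: "P 0 \<subseteq> P 1" using Cons.prems(2)[of 0] by simp
  have yc: "y \<in> carrier (mpoly_ring V)" using y(1) P1c(1) by blast
  have ysc: "x \<in> carrier (mpoly_ring V)" if "x \<in> set ys" for x
  proof -
    from that obtain i where i: "i < length ys" "ys ! i = x"
      unfolding in_set_conv_nth by blast
    then have "x \<in> P (Suc (Suc i))" using Cons.prems(3)[of "Suc i"] by simp
    then show ?thesis
      using mpoly_ideal_closed(1)[OF primeideal.axioms(1)[OF Cons.prems(1)[of "Suc (Suc i)"]]] i by auto
  qed
  note powc = power_mem_mpoly_ring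
  have ppc: "power_product ys e \<in> carrier (mpoly_ring V)" if "length e = length ys" for e
    using that ysc by (rule power_product_mem_mpoly_ring)
  define m where "m = Min (hd ` Es)"
  have m: "m \<in> hd ` Es" "\<And>e. e \<in> Es \<Longrightarrow> m \<le> hd e"
    unfolding m_def using Cons.prems(4,5) by (simp_all add: Min_in)
  define t where "t e = Poly_Mapping.single 0 (c e) * (y ^ (hd e - m) * power_product ys (tl e))" for e
  have e: "e = hd e # tl e" "length (tl e) = length ys" if "e \<in> Es" for e
    using Cons.prems(6)[OF that] by (cases e; simp)+
  have tc: "t e \<in> carrier (mpoly_ring V)" if "e \<in> Es" for e
    unfolding t_def using ppc powc yc e(2)[OF that] by (intro mpoly_ring_closed single_mem_mpoly_ring) auto
  have factor: "Poly_Mapping.single 0 (c e) * power_product (y # ys) e = y ^ m * t e" if "e \<in> Es" for e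
  proof -
    have "power_product (y # ys) e = y ^ hd e * power_product ys (tl e)"
      by (subst e(1)[OF that]) simp
    also have "y ^ hd e = y ^ m * y ^ (hd e - m)"
      using m(2)[OF that] by (simp flip: power_add)
    finally show ?thesis unfolding t_def by (simp add: ac_simps)
  qed
  have "y ^ m * sum t Es \<in> P 0"
    using Cons.prems(7) factor by (simp add: sum_distrib_left)
  moreover have tsc: "sum t Es \<in> carrier (mpoly_ring V)"
    by (rule sum_mem_closed[OF zero_mem_mpoly_ring mpoly_ring_closed(1) tc])
  ultimately have "y ^ m \<otimes>\<^bsub>mpoly_ring V\<^esub> sum t Es \<in> P 0" by simp
  from P0.I_prime[OF powc[OF yc] tsc this] have "sum t Es \<in> P 0"
    using prime_power_mem[OF P0.primeideal yc, of m] y(2) by blast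
  then have T: "sum t Es \<in> P 1" using P01 by blast
  define Es1 where "Es1 = {e \<in> Es. hd e = m}"
  have "sum t (Es - Es1) \<in> P 1"
  proof (rule sum_mem_closed)
    fix e assume "e \<in> Es - Es1"
    then have eE: "e \<in> Es" and "m < hd e" using m(2)[of e] unfolding Es1_def by auto
    then obtain j where "hd e - m = Suc j" by (metis Suc_diff_Suc)
    then have "t e = (Poly_Mapping.single 0 (c e) * (y ^ j * power_product ys (tl e))) * y"
      unfolding t_def by (simp add: ac_simps)
    moreover have "Poly_Mapping.single 0 (c e) * (y ^ j * power_product ys (tl e)) \<in> carrier (mpoly_ring V)"
      by (intro mpoly_ring_closed single_mem_mpoly_ring ppc powc yc e(2)[OF eE]) simp
    ultimately show "t e \<in> P 1" using P1c(4)[OF y(1)] by simp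
  qed (fact P1c(2), fact P1c(3))
  moreover have "sum t Es1 = sum t Es - sum t (Es - Es1)"
    using sum.subset_diff[of Es1 Es t] Cons.prems(4) unfolding Es1_def by (simp add: algebra_simps)
  ultimately have T1: "sum t Es1 \<in> P 1" using T P1c(5) by simp
  have inj: "inj_on tl Es1"
  proof (rule inj_onI)
    fix x x' assume "x \<in> Es1" "x' \<in> Es1" "tl x = tl x'"
    then show "x = x'" using e(1)[of x] e(1)[of x'] unfolding Es1_def by simp
  qed
  have "sum t Es1 = (\<Sum>e\<in>tl ` Es1. Poly_Mapping.single 0 (c (m # e)) * power_product ys e)"
    unfolding sum.reindex[OF inj] o_def
  proof (rule sum.cong)
    fix x assume "x \<in> Es1"
    then have x: "x \<in> Es" "hd x = m" unfolding Es1_def by auto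
    then have "x = m # tl x" using e(1)[OF x(1)] by simp
    then show "t x = Poly_Mapping.single 0 (c (m # tl x)) * power_product ys (tl x)"
      unfolding t_def using x(2) by simp
  qed simp
  then have rel: "(\<Sum>e\<in>tl ` Es1. Poly_Mapping.single 0 (c (m # e)) * power_product ys e) \<in> P 1"
    using T1 by simp
  show False
  proof (rule Cons.IH[of "\<lambda>i. P (Suc i)" "tl ` Es1" "\<lambda>e. c (m # e)"])
    show "finite (tl ` Es1)" using Cons.prems(4) unfolding Es1_def by simp
    show "tl ` Es1 \<noteq> {}" using m(1) unfolding Es1_def by blast
    show "length e' = length ys \<and> c (m # e') \<noteq> 0" if "e' \<in> tl ` Es1" for e'
    proof -
      from that obtain x where x: "x \<in> Es" "hd x = m" "e' = tl x" unfolding Es1_def by blast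
      then have "x = m # e'" using e(1)[OF x(1)] by simp
      then show ?thesis using Cons.prems(6)[OF x(1)] by simp
    qed
    show "primeideal (P (Suc i)) (mpoly_ring V)" if "i \<le> length ys" for i
      using Cons.prems(1)[of "Suc i"] that by simp
    show "P (Suc i) \<subseteq> P (Suc (Suc i))" if "i < length ys" for i
      using Cons.prems(2)[of "Suc i"] that by simp
    show "ys ! i \<in> P (Suc (Suc i)) - P (Suc i)" if "i < length ys" for i
      using Cons.prems(3)[of "Suc i"] that by simp
    show "(\<Sum>e\<in>tl ` Es1. Poly_Mapping.single 0 (c (m # e)) * power_product ys e) \<in> P (Suc 0)"
      using rel by simp
  qed
qed

text \<open>The dimension bound for polynomial rings, in a form adapted to monomial ideals. Modulo the variables in
\<open>P 0\<close>, the witnesses of the strict inclusions may be taken in the variables outside \<open>P 0\<close>. If there were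
more witnesses than such variables, they would be algebraically dependent.\<close>

lemma prime_chain_length_le:
  fixes P :: "nat \<Rightarrow> 'k::field mpoly set"
  assumes "finite V" and P: "\<And>i. i \<le> d \<Longrightarrow> primeideal (P i) (mpoly_ring V)"
    and chain: "\<And>i. i < d \<Longrightarrow> P i \<subset> P (Suc i)"
  shows "d \<le> card {i \<in> V. mpoly_var i \<notin> P 0}"
proof (rule ccontr)
  define F where "F = {i \<in> V. mpoly_var i \<notin> P 0}"
  assume "\<not> d \<le> card {i \<in> V. mpoly_var i \<notin> P 0}"
  then have d: "card F < d" unfolding F_def by simp
  have P0: "P 0 \<subseteq> P i" if "i \<le> d" for i
    using that
  proof (induction i)
    case (Suc i)
    then show ?case using chain[of i] by auto
  qed simp
  have id: "ideal (P i) (mpoly_ring V)" if "i \<le> d" for i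
    using P[OF that] by (rule primeideal.axioms)
  have "\<exists>y. y \<in> P (Suc i) - P i \<and> (\<forall>m\<in>Poly_Mapping.keys y. Poly_Mapping.keys m \<subseteq> F)" if i: "i < d" for i
  proof -
    obtain z where z: "z \<in> P (Suc i)" "z \<notin> P i" using chain[OF i] by blast
    have zc: "z \<in> carrier (mpoly_ring V)" using mpoly_ideal_closed(1)[OF id[of "Suc i"]] z(1) i by auto
    \<comment> \<open>The omitted terms of \<open>z\<close> are divisible by variables in \<open>P 0\<close>.\<close>
    define y where "y = restrict_vars F z"
    have zy: "z - y \<in> P 0"
      unfolding y_def by (rule diff_restrict_vars_mem[OF id zc]) (auto simp: F_def)
    have "y \<in> P (Suc i)"
      using mpoly_ideal_closed(5)[OF id[of "Suc i"] z(1), of "z - y"] zy P0[of "Suc i"] i by auto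
    moreover have "y \<notin> P i"
    proof
      assume "y \<in> P i"
      moreover have "z - y \<in> P i" using zy P0[of i] i by auto
      ultimately have "y + (z - y) \<in> P i"
        using i by (intro mpoly_ideal_closed(3)[OF id]) auto
      then show False using z(2) by simp
    qed
    ultimately show ?thesis
      by (intro exI[of _ y]) (auto simp: keys_restrict_vars y_def)
  qed
  then obtain y where y: "\<And>i. i < d \<Longrightarrow> y i \<in> P (Suc i) - P i"
    "\<And>i m. i < d \<Longrightarrow> m \<in> Poly_Mapping.keys (y i) \<Longrightarrow> Poly_Mapping.keys m \<subseteq> F" by metis
  define ys where "ys = map y [0..<d]"
  have "finite F" using assms(1) unfolding F_def by simp
  have "card F < length ys" using d unfolding ys_def by simp
  moreover have "Poly_Mapping.keys m \<subseteq> F" if "x \<in> set ys" "m \<in> Poly_Mapping.keys x" for x m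
  proof -
    from that(1) obtain i where "i < d" "x = y i" unfolding ys_def by auto
    then show ?thesis using y(2) that(2) by blast
  qed
  ultimately obtain Es c where Es: "finite Es" "Es \<noteq> {}"
    "\<And>e. e \<in> Es \<Longrightarrow> length e = length ys \<and> c e \<noteq> 0"
    "(\<Sum>e\<in>Es. Poly_Mapping.single 0 (c e) * power_product ys e) = 0"
    using algebraic_dependence[OF \<open>finite F\<close>, of ys] by blast
  show False
  proof (rule no_relation_along_prime_chain[of ys P V Es c])
    show "primeideal (P i) (mpoly_ring V)" if "i \<le> length ys" for i
      using P[of i] that unfolding ys_def by simp
    show "P i \<subseteq> P (Suc i)" if "i < length ys" for i
      using chain[of i] that unfolding ys_def by auto
    show "ys ! i \<in> P (Suc i) - P i" if "i < length ys" for i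
      using y(1)[of i] that unfolding ys_def by simp
    show "(\<Sum>e\<in>Es. Poly_Mapping.single 0 (c e) * power_product ys e) \<in> P 0"
      unfolding Es(4) by (rule mpoly_ideal_closed(2)[OF id]) simp
  qed (fact Es)+
qed

section \<open>Monomial ideals\<close>

lemma keys_add_nat:
  "Poly_Mapping.keys (a + b :: 'a \<Rightarrow>\<^sub>0 nat) = Poly_Mapping.keys a \<union> Poly_Mapping.keys b"
  by (auto simp: in_keys_iff lookup_add)

definition up_closed :: "('a \<Rightarrow>\<^sub>0 nat) set \<Rightarrow> bool" where
  "up_closed U \<longleftrightarrow> (\<forall>m\<in>U. \<forall>c. m + c \<in> U)"

text \<open>The span of the monomials over \<open>V\<close> with exponent in \<open>U\<close>; it is an ideal as soon as \<open>U\<close> is closed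
under adding exponents.\<close>

definition monomial_ideal :: "nat set \<Rightarrow> (nat \<Rightarrow>\<^sub>0 nat) set \<Rightarrow> 'k::field mpoly set" where
  "monomial_ideal V U = {p. \<forall>m\<in>Poly_Mapping.keys p. Poly_Mapping.keys m \<subseteq> V \<and> m \<in> U}"

lemma single_mem_monomial_ideal_iff:
  "Poly_Mapping.single m c \<in> monomial_ideal V U \<longleftrightarrow> c = 0 \<or> Poly_Mapping.keys m \<subseteq> V \<and> m \<in> U"
  by (simp add: monomial_ideal_def)

lemma ideal_monomial_ideal:
  assumes "up_closed U"
  shows "ideal (monomial_ideal V U :: 'k::field mpoly set) (mpoly_ring V)"
proof (rule ideal_mpoly_ringI)
  show "monomial_ideal V U \<subseteq> carrier (mpoly_ring V)"
    by (auto simp: monomial_ideal_def mem_mpoly_ring_iff)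
  show "0 \<in> monomial_ideal V U" by (simp add: monomial_ideal_def)
  show "p + q \<in> monomial_ideal V U"
    if "p \<in> monomial_ideal V U" "q \<in> monomial_ideal V U" for p q :: "'k mpoly"
    using that Poly_Mapping.keys_add[of p q] unfolding monomial_ideal_def by blast
  fix p r :: "'k mpoly" assume p: "p \<in> monomial_ideal V U" and r: "r \<in> carrier (mpoly_ring V)"
  show "r * p \<in> monomial_ideal V U"
    unfolding monomial_ideal_def
  proof safe
    fix m assume "m \<in> Poly_Mapping.keys (r * p)"
    then obtain a b where ab: "m = a + b" "a \<in> Poly_Mapping.keys r" "b \<in> Poly_Mapping.keys p"
      using keys_mult[of r p] by blast
    have "b \<in> U" "Poly_Mapping.keys b \<subseteq> V" using p ab(3) unfolding monomial_ideal_def by auto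
    moreover have "Poly_Mapping.keys a \<subseteq> V" using r ab(2) unfolding mem_mpoly_ring_iff by blast
    ultimately show "m \<in> U" "\<And>x. x \<in> Poly_Mapping.keys m \<Longrightarrow> x \<in> V"
      using assms unfolding ab(1) up_closed_def keys_add_nat by (auto simp: add.commute[of a b])
  qed
qed

lemma monomial_ideal_prod:
  fixes V :: "nat set"
  assumes U: "up_closed U" and W: "up_closed W"
  shows "ideal_prod (mpoly_ring V) (monomial_ideal V U :: 'k::field mpoly set) (monomial_ideal V W) =
    monomial_ideal V {u + w | u w. u \<in> U \<and> w \<in> W}" (is "?P = ?Q")
proof
  show "?P \<subseteq> ?Q"
  proof
    fix s assume "s \<in> ?P"
    then show "s \<in> ?Q"
    proof induction
      case (prod i j)
      show ?case
        unfolding monomial_ideal_def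
      proof safe
        fix m assume "m \<in> Poly_Mapping.keys (i \<otimes>\<^bsub>mpoly_ring V\<^esub> j)"
        then obtain a b where ab: "m = a + b" "a \<in> Poly_Mapping.keys i" "b \<in> Poly_Mapping.keys j"
          using keys_mult[of i j] by auto
        then have *: "a \<in> U" "Poly_Mapping.keys a \<subseteq> V" "b \<in> W" "Poly_Mapping.keys b \<subseteq> V"
          using prod unfolding monomial_ideal_def by auto
        show "\<exists>u w. m = u + w \<and> u \<in> U \<and> w \<in> W" using ab(1) * by blast
        show "x \<in> V" if "x \<in> Poly_Mapping.keys m" for x
          using that * unfolding ab(1) keys_add_nat by blast
      qed
    next
      case (sum s1 s2)
      then show ?case using Poly_Mapping.keys_add[of s1 s2] unfolding monomial_ideal_def by fastforce
    qed
  qed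
  show "?Q \<subseteq> ?P"
  proof
    fix p assume p: "p \<in> ?Q"
    show "p \<in> ?P"
    proof (rule mem_if_terms_mem)
      have "0 \<otimes>\<^bsub>mpoly_ring V\<^esub> 0 \<in> ?P"
        by (rule ideal_prod.prod) (simp_all add: monomial_ideal_def)
      then show "0 \<in> ?P" by simp
      show "q + r \<in> ?P" if "q \<in> ?P" "r \<in> ?P" for q r
        using ideal_prod.sum[OF that] by simp
      fix m assume "m \<in> Poly_Mapping.keys p"
      then have m: "Poly_Mapping.keys m \<subseteq> V" "m \<in> {u + w | u w. u \<in> U \<and> w \<in> W}"
        using p unfolding monomial_ideal_def by auto
      then obtain u w where uw: "m = u + w" "u \<in> U" "w \<in> W" by blast
      have "Poly_Mapping.single u (Poly_Mapping.lookup p m) \<in> monomial_ideal V U"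
        "Poly_Mapping.single w 1 \<in> monomial_ideal V W"
        using uw m(1) unfolding single_mem_monomial_ideal_iff by (auto simp: keys_add_nat)
      from ideal_prod.prod[OF this, of "mpoly_ring V"]
      show "Poly_Mapping.single m (Poly_Mapping.lookup p m) \<in> ?P"
        by (simp add: mult_single uw(1))
    qed
  qed
qed

text \<open>The empty power is the unit ideal, whence \<open>UNIV\<close>.\<close>

primrec power_exponents :: "('a \<Rightarrow>\<^sub>0 nat) set \<Rightarrow> nat \<Rightarrow> ('a \<Rightarrow>\<^sub>0 nat) set" where
  "power_exponents U 0 = UNIV"
| "power_exponents U (Suc k) = {u + w | u w. u \<in> power_exponents U k \<and> w \<in> U}"

lemma up_closed_power_exponents:
  assumes "up_closed U"
  shows "up_closed (power_exponents U k)"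
proof (cases k)
  case (Suc l)
  show ?thesis
    unfolding Suc up_closed_def
  proof (intro ballI allI)
    fix m c assume "m \<in> power_exponents U (Suc l)"
    then obtain u w where uw: "m = u + w" "u \<in> power_exponents U l" "w \<in> U" by auto
    have "m + c = u + (w + c)" unfolding uw(1) by (rule add.assoc)
    moreover have "w + c \<in> U" using assms uw(3) unfolding up_closed_def by blast
    ultimately show "m + c \<in> power_exponents U (Suc l)" using uw(2) by auto
  qed
qed (simp add: up_closed_def)

lemma monomial_ideal_power:
  assumes "up_closed U"
  shows "(monomial_ideal V U :: 'k::field mpoly set) [^]\<^bsub>ideals_set (mpoly_ring V)\<^esub> k =
    monomial_ideal V (power_exponents U k)"
proof (induction k)
  case 0
  have "monomial_ideal V UNIV = carrier (mpoly_ring V :: 'k mpoly ring)"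
    by (simp add: monomial_ideal_def mpoly_ring_def)
  then show ?case by (simp add: nat_pow_def ideals_set_def)
next
  case (Suc k)
  have "(monomial_ideal V U :: 'k mpoly set) [^]\<^bsub>ideals_set (mpoly_ring V)\<^esub> Suc k =
      ideal_prod (mpoly_ring V) (monomial_ideal V U [^]\<^bsub>ideals_set (mpoly_ring V)\<^esub> k) (monomial_ideal V U)"
    by (simp add: nat_pow_def ideals_set_def)
  also have "\<dots> = monomial_ideal V (power_exponents U (Suc k))"
    unfolding Suc monomial_ideal_prod[OF up_closed_power_exponents[OF assms] assms] by simp
  finally show ?case .
qed

definition variable_ideal :: "nat set \<Rightarrow> nat set \<Rightarrow> 'k::field mpoly set" where
  "variable_ideal V A = monomial_ideal V {m. Poly_Mapping.keys m \<inter> A \<noteq> {}}"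

lemma up_closed_meets: "up_closed {m. Poly_Mapping.keys m \<inter> A \<noteq> {}}"
  by (auto simp: up_closed_def keys_add_nat)

lemma ideal_variable_ideal: "ideal (variable_ideal V A) (mpoly_ring V)"
  unfolding variable_ideal_def by (rule ideal_monomial_ideal[OF up_closed_meets])

lemma var_mem_variable_ideal_iff:
  assumes "i \<in> V"
  shows "(mpoly_var i :: 'k::field mpoly) \<in> variable_ideal V A \<longleftrightarrow> i \<in> A"
  using assms unfolding variable_ideal_def mpoly_var_def single_mem_monomial_ideal_iff by simp

lemma variable_ideal_subset:
  fixes P :: "'k::field mpoly set"
  assumes P: "ideal P (mpoly_ring V)" and A: "\<And>i. i \<in> A \<Longrightarrow> i \<in> V \<Longrightarrow> mpoly_var i \<in> P"
  shows "variable_ideal V A \<subseteq> P"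
proof
  fix p :: "'k mpoly" assume p: "p \<in> variable_ideal V A"
  show "p \<in> P"
  proof (rule mem_if_terms_mem)
    fix m assume "m \<in> Poly_Mapping.keys p"
    then have m: "Poly_Mapping.keys m \<subseteq> V" "Poly_Mapping.keys m \<inter> A \<noteq> {}"
      using p unfolding variable_ideal_def monomial_ideal_def by auto
    then obtain i where i: "i \<in> Poly_Mapping.keys m" "i \<in> A" by blast
    then have "mpoly_var i \<in> P" using A m(1) by blast
    then show "Poly_Mapping.single m (Poly_Mapping.lookup p m) \<in> P"
      using single_mem_ideal_if_var_mem[OF P _ i(1) m(1)] by blast
  next
    show "0 \<in> P" by (rule mpoly_ideal_closed(2)[OF P])
    show "q + r \<in> P" if "q \<in> P" "r \<in> P" for q r
      by (rule mpoly_ideal_closed(3)[OF P that])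
  qed
qed

lemma variable_ideal_mono: "A \<subseteq> B \<Longrightarrow> variable_ideal V A \<subseteq> variable_ideal V B"
  unfolding variable_ideal_def monomial_ideal_def by blast

text \<open>Modulo the variables in \<open>A\<close>, the factors may be replaced by their parts in the remaining variables. The
product of these parts is in the ideal only if it is \<open>0\<close>, and polynomials have no zero divisors.\<close>

lemma primeideal_variable_ideal:
  "primeideal (variable_ideal V A :: 'k::field mpoly set) (mpoly_ring V)"
proof (rule primeidealI[OF ideal_variable_ideal cring_mpoly_ring])
  note closed = mpoly_ideal_closed[OF ideal_variable_ideal[of V A]]
  have "(1 :: 'k mpoly) \<notin> variable_ideal V A"
    by (simp add: variable_ideal_def monomial_ideal_def)
  then show "carrier (mpoly_ring V) \<noteq> (variable_ideal V A :: 'k mpoly set)"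
    using one_mem_mpoly_ring by blast
  fix p q :: "'k mpoly"
  assume p: "p \<in> carrier (mpoly_ring V)" and q: "q \<in> carrier (mpoly_ring V)"
    and pq: "p \<otimes>\<^bsub>mpoly_ring V\<^esub> q \<in> variable_ideal V A"
  define p' q' where "p' = restrict_vars (- A) p" and "q' = restrict_vars (- A) q"
  have diff: "r - restrict_vars (- A) r \<in> variable_ideal V A"
    if "r \<in> carrier (mpoly_ring V)" for r :: "'k mpoly"
    by (rule diff_restrict_vars_mem[OF ideal_variable_ideal that])
      (simp add: var_mem_variable_ideal_iff)
  have sub: "Poly_Mapping.keys (restrict_vars (- A) r) \<subseteq> Poly_Mapping.keys r" for r :: "'k mpoly"
    unfolding keys_restrict_vars by blast
  have q'c: "q' \<in> carrier (mpoly_ring V)"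
    using q sub[of q] unfolding q'_def mem_mpoly_ring_iff by blast
  have "p * (q - q') \<in> variable_ideal V A" "q' * (p - p') \<in> variable_ideal V A"
    unfolding p'_def q'_def
    by (rule closed(4)[OF diff[OF q] p], rule closed(4)[OF diff[OF p] q'c[unfolded q'_def]])
  then have "p * (q - q') + q' * (p - p') \<in> variable_ideal V A" by (rule closed(3))
  moreover have "p * q \<in> variable_ideal V A" using pq by simp
  ultimately have "p * q - (p * (q - q') + q' * (p - p')) \<in> variable_ideal V A" by (intro closed(5))
  also have "p * q - (p * (q - q') + q' * (p - p')) = p' * q'" by (simp add: algebra_simps)
  finally have p'q': "p' * q' \<in> variable_ideal V A" .
  have "Poly_Mapping.keys m \<inter> A = {}" if "m \<in> Poly_Mapping.keys (p' * q')" for m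
  proof -
    from that obtain a b where ab: "m = a + b" "a \<in> Poly_Mapping.keys p'" "b \<in> Poly_Mapping.keys q'"
      using keys_mult[of p' q'] by blast
    then show ?thesis unfolding p'_def q'_def keys_restrict_vars by (auto simp: keys_add_nat)
  qed
  then have "Poly_Mapping.keys (p' * q') = {}"
    using p'q' unfolding variable_ideal_def monomial_ideal_def by blast
  then have "p' * q' = 0" by simp
  then have "p' = 0 \<or> q' = 0" by simp
  then show "p \<in> variable_ideal V A \<or> q \<in> variable_ideal V A"
    using diff[OF p] diff[OF q] unfolding p'_def q'_def by auto
qed

lemma power_exponents_meets:
  assumes "finite A"
  shows "power_exponents {m. Poly_Mapping.keys m \<inter> A \<noteq> {}} k = {m. k \<le> sum (Poly_Mapping.lookup m) A}"
proof (induction k)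
  case 0
  show ?case by simp
next
  case (Suc k)
  show ?case
  proof (intro equalityI subsetI)
    fix m assume "m \<in> power_exponents {m. Poly_Mapping.keys m \<inter> A \<noteq> {}} (Suc k)"
    then obtain u w i where uw: "m = u + w" "k \<le> sum (Poly_Mapping.lookup u) A"
      and i: "i \<in> Poly_Mapping.keys w" "i \<in> A"
      unfolding power_exponents.simps Suc by blast
    have "0 < Poly_Mapping.lookup w i" using i(1) by (simp add: in_keys_iff)
    also have "\<dots> \<le> sum (Poly_Mapping.lookup w) A" by (rule member_le_sum) (use i assms in auto)
    finally show "m \<in> {m. Suc k \<le> sum (Poly_Mapping.lookup m) A}"
      using uw(2) unfolding uw(1) by (simp add: lookup_add sum.distrib)
  next
    fix m assume "m \<in> {m. Suc k \<le> sum (Poly_Mapping.lookup m) A}"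
    then have m: "Suc k \<le> sum (Poly_Mapping.lookup m) A" by simp
    then have "sum (Poly_Mapping.lookup m) A \<noteq> 0" by linarith
    then obtain i where i: "i \<in> A" "Poly_Mapping.lookup m i \<noteq> 0"
      by (meson sum.neutral)
    define e :: "'a \<Rightarrow>\<^sub>0 nat" where "e = Poly_Mapping.single i 1"
    have eq: "m = (m - e) + e"
      unfolding e_def using i(2)
      by (intro poly_mapping_eqI) (auto simp: lookup_add lookup_minus lookup_single when_def)
    have "sum (Poly_Mapping.lookup e) A = 1"
      unfolding e_def lookup_single when_def using i(1) assms by simp
    then have "k \<le> sum (Poly_Mapping.lookup (m - e)) A"
      using m by (subst (asm) eq) (simp add: lookup_add sum.distrib)
    moreover have "e \<in> {m. Poly_Mapping.keys m \<inter> A \<noteq> {}}" unfolding e_def using i(1) by simp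
    ultimately show "m \<in> power_exponents {m. Poly_Mapping.keys m \<inter> A \<noteq> {}} (Suc k)"
      unfolding power_exponents.simps Suc using eq by blast
  qed
qed

lemma variable_ideal_power:
  assumes "finite A"
  shows "(variable_ideal V A :: 'k::field mpoly set) [^]\<^bsub>ideals_set (mpoly_ring V)\<^esub> k =
    monomial_ideal V {m. k \<le> sum (Poly_Mapping.lookup m) A}"
  unfolding variable_ideal_def monomial_ideal_power[OF up_closed_meets] power_exponents_meets[OF assms] ..

section \<open>Powers and symbolic powers of the edge ideal\<close>

definition edge_exponents :: "'a rel \<Rightarrow> ('a \<Rightarrow>\<^sub>0 nat) set" where
  "edge_exponents E = {c + Poly_Mapping.single i 1 + Poly_Mapping.single j 1 | c i j. (i, j) \<in> E}"

lemma up_closed_edge_exponents: "up_closed (edge_exponents E)"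
  unfolding up_closed_def edge_exponents_def
proof safe
  fix b c :: "'a \<Rightarrow>\<^sub>0 nat" and i j assume E: "(i, j) \<in> E"
  have "b + Poly_Mapping.single i 1 + Poly_Mapping.single j 1 + c =
      (b + c) + Poly_Mapping.single i 1 + Poly_Mapping.single j 1"
    by (simp add: ac_simps)
  then show "\<exists>c' i' j'. b + Poly_Mapping.single i 1 + Poly_Mapping.single j 1 + c =
      c' + Poly_Mapping.single i' 1 + Poly_Mapping.single j' 1 \<and> (i', j') \<in> E"
    using E by blast
qed

lemma var_mult_var:
  "mpoly_var i * mpoly_var j =
    (Poly_Mapping.single (Poly_Mapping.single i 1 + Poly_Mapping.single j 1) 1 :: 'k::field mpoly)"
  by (simp add: mpoly_var_def mult_single)

lemma edge_ideal_eq: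
  assumes "arcs_ends G \<subseteq> {1..n} \<times> {1..n}"
  shows "(edge_ideal n G :: 'k::field mpoly set) = monomial_ideal {1..n} (edge_exponents (arcs_ends G))"
proof -
  let ?V = "{1..n}" and ?S = "mpoly_ring {1..n} :: 'k mpoly ring"
  let ?gens = "{mpoly_var i * mpoly_var j | i j. i \<rightarrow>\<^bsub>G\<^esub> j} :: 'k mpoly set"
  let ?M = "monomial_ideal {1..n} (edge_exponents (arcs_ends G)) :: 'k mpoly set"
  interpret S: cring ?S by (rule cring_mpoly_ring)
  have gens: "?gens \<subseteq> ?M"
  proof safe
    fix i j assume ij: "i \<rightarrow>\<^bsub>G\<^esub> j"
    then have "0 + Poly_Mapping.single i 1 + Poly_Mapping.single j 1 \<in> edge_exponents (arcs_ends G)"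
      unfolding edge_exponents_def by blast
    then show "mpoly_var i * mpoly_var j \<in> ?M"
      unfolding var_mult_var single_mem_monomial_ideal_iff using ij assms by (auto simp: keys_add_nat)
  qed
  have M: "ideal ?M ?S" by (rule ideal_monomial_ideal[OF up_closed_edge_exponents])
  have gens_carr: "?gens \<subseteq> carrier ?S" using gens mpoly_ideal_closed(1)[OF M] by (rule order_trans)
  have id: "ideal (genideal ?S ?gens) ?S" by (rule S.genideal_ideal[OF gens_carr])
  have "genideal ?S ?gens \<subseteq> ?M" by (rule S.genideal_minimal[OF M gens])
  moreover have "?M \<subseteq> genideal ?S ?gens"
  proof
    fix p assume p: "p \<in> ?M"
    show "p \<in> genideal ?S ?gens"
    proof (rule mem_if_terms_mem)
      fix m assume "m \<in> Poly_Mapping.keys p"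
      then have m: "Poly_Mapping.keys m \<subseteq> ?V" "m \<in> edge_exponents (arcs_ends G)"
        using p unfolding monomial_ideal_def by auto
      then obtain c i j where cij: "m = c + Poly_Mapping.single i 1 + Poly_Mapping.single j 1" "i \<rightarrow>\<^bsub>G\<^esub> j"
        unfolding edge_exponents_def by blast
      have "mpoly_var i * mpoly_var j \<in> ?gens" using cij(2) by blast
      then have g: "mpoly_var i * mpoly_var j \<in> genideal ?S ?gens"
        using S.genideal_self[OF gens_carr] by (rule subsetD[rotated])
      have "Poly_Mapping.keys c \<subseteq> ?V" using m(1) unfolding cij(1) keys_add_nat by blast
      from mpoly_ideal_closed(4)[OF id g single_mem_mpoly_ring[OF this, of "Poly_Mapping.lookup p m"]]
      show "Poly_Mapping.single m (Poly_Mapping.lookup p m) \<in> genideal ?S ?gens"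
        by (simp add: var_mult_var mult_single cij(1) add.assoc)
    next
      show "0 \<in> genideal ?S ?gens" by (rule mpoly_ideal_closed(2)[OF id])
      show "q + r \<in> genideal ?S ?gens" if "q \<in> genideal ?S ?gens" "r \<in> genideal ?S ?gens" for q r
        by (rule mpoly_ideal_closed(3)[OF id that])
    qed
  qed
  ultimately show ?thesis unfolding edge_ideal_def by (rule equalityI)
qed

lemma power_exponents_edge_exponents:
  "power_exponents (edge_exponents E) k = {m. packs E k (Poly_Mapping.lookup m)}"
proof (induction k)
  case 0
  show ?case by (auto intro: packs.zero)
next
  case (Suc k)
  show ?case
  proof (intro equalityI subsetI)
    fix m assume "m \<in> power_exponents (edge_exponents E) (Suc k)"
    then obtain u c i j where m: "m = u + (c + Poly_Mapping.single i 1 + Poly_Mapping.single j 1)"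
      "packs E k (Poly_Mapping.lookup u)" "(i, j) \<in> E"
      unfolding power_exponents.simps Suc unfolding edge_exponents_def by blast
    have "packs E (Suc k) (Poly_Mapping.lookup m)"
      by (rule packs_mono[OF packs.Suc[OF m(2,3)]])
        (simp add: m(1) lookup_add lookup_single when_def of_bool_def)
    then show "m \<in> {m. packs E (Suc k) (Poly_Mapping.lookup m)}" by simp
  next
    fix m assume "m \<in> {m. packs E (Suc k) (Poly_Mapping.lookup m)}"
    then have "packs E (Suc k) (Poly_Mapping.lookup m)" by simp
    then obtain a u v where *: "Poly_Mapping.lookup m = (\<lambda>x. a x + of_bool (x = u) + of_bool (x = v))"
      "packs E k a" "(u, v) \<in> E"
      by (cases rule: packs.cases) auto
    define e :: "'a \<Rightarrow>\<^sub>0 nat" where "e = 0 + Poly_Mapping.single u 1 + Poly_Mapping.single v 1"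
    have e: "Poly_Mapping.lookup e x = of_bool (x = u) + of_bool (x = v)" for x
      unfolding e_def by (auto simp: lookup_add lookup_single when_def of_bool_def)
    have "Poly_Mapping.lookup (m - e) = a" by (rule ext) (simp add: lookup_minus e *(1))
    then have "m - e \<in> power_exponents (edge_exponents E) k" unfolding Suc using *(2) by simp
    moreover have "e \<in> edge_exponents E" unfolding edge_exponents_def e_def using *(3) by blast
    moreover have "m = (m - e) + e"
      by (rule poly_mapping_eqI) (simp add: lookup_add lookup_minus e *(1))
    ultimately show "m \<in> power_exponents (edge_exponents E) (Suc k)"
      unfolding power_exponents.simps by blast
  qed
qed

lemma edge_ideal_power:
  assumes "arcs_ends G \<subseteq> {1..n} \<times> {1..n}"
  shows "(edge_ideal n G :: 'k::field mpoly set) [^]\<^bsub>ideals_set (mpoly_ring {1..n})\<^esub> k =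
    monomial_ideal {1..n} {m. packs (arcs_ends G) k (Poly_Mapping.lookup m)}"
  unfolding edge_ideal_eq[OF assms] monomial_ideal_power[OF up_closed_edge_exponents]
    power_exponents_edge_exponents ..

lemma vertex_cover_if_edge_ideal_subset:
  assumes E: "arcs_ends G \<subseteq> {1..n} \<times> {1..n}"
    and P: "primeideal P (mpoly_ring {1..n} :: 'k::field mpoly ring)" and sub: "edge_ideal n G \<subseteq> P"
  shows "vertex_cover (arcs_ends G) {i \<in> {1..n}. mpoly_var i \<in> P}"
proof -
  interpret P: primeideal P "mpoly_ring {1..n} :: 'k mpoly ring" by fact
  have "i \<in> {i \<in> {1..n}. mpoly_var i \<in> P} \<or> j \<in> {i \<in> {1..n}. mpoly_var i \<in> P}"
    if ij: "i \<rightarrow>\<^bsub>G\<^esub> j" for i j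
  proof -
    have V: "i \<in> {1..n}" "j \<in> {1..n}" using ij E by auto
    then have vc: "mpoly_var i \<in> carrier (mpoly_ring {1..n} :: 'k mpoly ring)"
      "mpoly_var j \<in> carrier (mpoly_ring {1..n} :: 'k mpoly ring)"
      unfolding mpoly_var_def by (auto intro: single_mem_mpoly_ring)
    have "0 + Poly_Mapping.single i 1 + Poly_Mapping.single j 1 \<in> edge_exponents (arcs_ends G)"
      unfolding edge_exponents_def using ij by blast
    then have "mpoly_var i * mpoly_var j \<in> (edge_ideal n G :: 'k mpoly set)"
      unfolding edge_ideal_eq[OF E] var_mult_var single_mem_monomial_ideal_iff
      using V by (auto simp: keys_add_nat)
    then have "mpoly_var i \<otimes>\<^bsub>mpoly_ring {1..n}\<^esub> mpoly_var j \<in> P" using sub by auto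
    from P.I_prime[OF vc this] V show ?thesis by blast
  qed
  then show ?thesis unfolding vertex_cover_def by blast
qed

lemma edge_ideal_subset_variable_ideal:
  assumes E: "arcs_ends G \<subseteq> {1..n} \<times> {1..n}" and A: "vertex_cover (arcs_ends G) A"
  shows "(edge_ideal n G :: 'k::field mpoly set) \<subseteq> variable_ideal {1..n} A"
proof -
  have "Poly_Mapping.keys m \<inter> A \<noteq> {}" if "m \<in> edge_exponents (arcs_ends G)" for m
    using that A unfolding edge_exponents_def vertex_cover_def by (fastforce simp: keys_add_nat)
  then show ?thesis unfolding edge_ideal_eq[OF E] variable_ideal_def monomial_ideal_def by blast
qed

text \<open>A prime containing the edge ideal contains the variables of a vertex cover, so that the minimal primes
are exactly the variable ideals of the minimal vertex covers. The condition is stated for all vertex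
covers, which is equivalent because each of them contains a minimal one.\<close>

lemma symbolic_power_edge_ideal:
  assumes E: "arcs_ends G \<subseteq> {1..n} \<times> {1..n}"
  shows "symbolic_power (mpoly_ring {1..n}) (edge_ideal n G :: 'k::field mpoly set) k =
    monomial_ideal {1..n}
      {m. \<forall>A\<subseteq>{1..n}. vertex_cover (arcs_ends G) A \<longrightarrow> k \<le> sum (Poly_Mapping.lookup m) A}"
    (is "?L = ?R")
proof (intro equalityI subsetI)
  let ?V = "{1..n}" and ?S = "mpoly_ring {1..n} :: 'k mpoly ring"
  let ?I = "edge_ideal n G :: 'k mpoly set"
  have fin: "finite A" if "A \<subseteq> ?V" for A using that finite_subset by blast
  fix p assume p: "p \<in> ?L"
  show "p \<in> ?R"
    unfolding monomial_ideal_def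
  proof (intro CollectI ballI conjI allI impI)
    fix m assume m: "m \<in> Poly_Mapping.keys p"
    show "Poly_Mapping.keys m \<subseteq> ?V"
      using p m unfolding symbolic_power_def mem_mpoly_ring_iff Int_iff by blast
    fix A assume A: "A \<subseteq> ?V" "vertex_cover (arcs_ends G) A"
    define T where "T = {B. B \<subseteq> A \<and> vertex_cover (arcs_ends G) B}"
    have "finite T" "A \<in> T" unfolding T_def using fin[OF A(1)] A(2) by auto
    then obtain B where B: "B \<in> T" and min: "\<And>C. C \<in> T \<Longrightarrow> C \<subseteq> B \<Longrightarrow> C = B"
      using finite_has_minimal2[of T A] by metis
    have BV: "B \<subseteq> ?V" and Bc: "vertex_cover (arcs_ends G) B" and BA: "B \<subseteq> A"
      using B A(1) unfolding T_def by auto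
    have "variable_ideal ?V B \<in> minimal_primes ?S ?I"
      unfolding minimal_primes_def
    proof (intro CollectI conjI allI impI)
      show "primeideal (variable_ideal ?V B) ?S" by (rule primeideal_variable_ideal)
      show "?I \<subseteq> variable_ideal ?V B" by (rule edge_ideal_subset_variable_ideal[OF E Bc])
      fix Q assume Q: "primeideal Q ?S \<and> ?I \<subseteq> Q \<and> Q \<subseteq> variable_ideal ?V B"
      define C where "C = {i \<in> ?V. mpoly_var i \<in> Q}"
      have "vertex_cover (arcs_ends G) C"
        unfolding C_def using Q by (intro vertex_cover_if_edge_ideal_subset[OF E]) auto
      moreover have "C \<subseteq> B"
        using Q var_mem_variable_ideal_iff[of _ ?V B] unfolding C_def by blast
      ultimately have "C = B" using BA by (intro min) (auto simp: T_def)
      then have "variable_ideal ?V B \<subseteq> Q"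
        using Q by (intro variable_ideal_subset primeideal.axioms(1)) (auto simp: C_def)
      then show "Q = variable_ideal ?V B" using Q by blast
    qed
    then have "p \<in> variable_ideal ?V B [^]\<^bsub>ideals_set ?S\<^esub> k"
      using p unfolding symbolic_power_def by blast
    then have "k \<le> sum (Poly_Mapping.lookup m) B"
      using m unfolding variable_ideal_power[OF fin[OF BV]] monomial_ideal_def by blast
    also have "\<dots> \<le> sum (Poly_Mapping.lookup m) A"
      by (rule sum_mono2[OF fin[OF A(1)] BA]) simp
    finally show "k \<le> sum (Poly_Mapping.lookup m) A" .
  qed
next
  let ?V = "{1..n}" and ?S = "mpoly_ring {1..n} :: 'k mpoly ring"
  let ?I = "edge_ideal n G :: 'k mpoly set"
  fix p assume p: "p \<in> ?R"
  have "p \<in> P [^]\<^bsub>ideals_set ?S\<^esub> k" if P: "P \<in> minimal_primes ?S ?I" for P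
  proof -
    have P': "primeideal P ?S" "?I \<subseteq> P"
      and min: "\<And>Q. primeideal Q ?S \<Longrightarrow> ?I \<subseteq> Q \<Longrightarrow> Q \<subseteq> P \<Longrightarrow> Q = P"
      using P unfolding minimal_primes_def by auto
    define A where "A = {i \<in> ?V. mpoly_var i \<in> P}"
    have A: "A \<subseteq> ?V" "vertex_cover (arcs_ends G) A"
      unfolding A_def using vertex_cover_if_edge_ideal_subset[OF E P'] by auto
    have fin: "finite A" using A(1) finite_subset by blast
    have "variable_ideal ?V A \<subseteq> P"
      by (rule variable_ideal_subset[OF primeideal.axioms(1)[OF P'(1)]]) (simp add: A_def)
    then have "P = variable_ideal ?V A"
      using min[OF primeideal_variable_ideal edge_ideal_subset_variable_ideal[OF E A(2)]] by simp
    then show ?thesis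
      using p A unfolding \<open>P = _\<close> variable_ideal_power[OF fin] monomial_ideal_def by blast
  qed
  moreover have "p \<in> carrier ?S"
    using p unfolding monomial_ideal_def mem_mpoly_ring_iff by blast
  ultimately show "p \<in> ?L" unfolding symbolic_power_def by blast
qed

section \<open>The annihilator of the quotient module\<close>

lemma (in cring) mem_annihilator_quotient_module_iff:
  assumes I: "ideal I R" and J: "ideal J R"
  shows "r \<in> annihilator R (quotient_module R J I) \<longleftrightarrow> r \<in> carrier R \<and> (\<forall>f\<in>J. r \<otimes> f \<in> I)"
proof -
  interpret I: ideal I R by (rule I)
  interpret J: ideal J R by (rule J)
  have smult: "(\<Union>x\<in>I +> f. I +> (r \<otimes> x)) = I +> (r \<otimes> f)" if r: "r \<in> carrier R" and f: "f \<in> carrier R" for r f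
  proof -
    have "I +> (r \<otimes> x) = I +> (r \<otimes> f)" if x: "x \<in> I +> f" for x
    proof -
      obtain i where i: "i \<in> I" "x = i \<oplus> f" using x unfolding a_r_coset_def' by blast
      have ic: "i \<in> carrier R" using i(1) by (rule I.Icarr)
      have "r \<otimes> x = r \<otimes> i \<oplus> r \<otimes> f" unfolding i(2) by (rule r_distr[OF ic f r])
      then have "I +> (r \<otimes> x) = (I +> (r \<otimes> i)) <+> (I +> (r \<otimes> f))"
        using I.a_rcos_sum[of "r \<otimes> i" "r \<otimes> f"] r f ic by simp
      also have "I +> (r \<otimes> i) = I +> \<zero>"
        using I.a_rcos_const[OF I.I_l_closed[OF i(1) r]] I.a_rcos_const[of \<zero>] I.zero_closed by simp
      also have "(I +> \<zero>) <+> (I +> (r \<otimes> f)) = I +> (r \<otimes> f)"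
        using I.a_rcos_sum[of \<zero> "r \<otimes> f"] r f by simp
      finally show ?thesis .
    qed
    then show ?thesis using I.a_rcos_self[OF f] by blast
  qed
  have zero: "I +> f = I \<longleftrightarrow> f \<in> I" if "f \<in> carrier R" for f
    using I.a_rcos_const I.rcos_const_imp_mem[OF that] by blast
  have "(\<Union>x\<in>I +> f. I +> (r \<otimes> x)) = I \<longleftrightarrow> r \<otimes> f \<in> I" if "r \<in> carrier R" "f \<in> J" for r f
    using smult[OF that(1) J.Icarr[OF that(2)]] zero that J.Icarr by simp
  then show ?thesis
    unfolding annihilator_def quotient_module_def by (cases "r \<in> carrier R") simp_all
qed

lemma lookup_mult_single_shift:
  fixes p :: "'k::field mpoly"
  shows "Poly_Mapping.lookup (p * Poly_Mapping.single w 1) (m + w) = Poly_Mapping.lookup p m"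
proof -
  have "p * Poly_Mapping.single w 1 =
      (\<Sum>a\<in>Poly_Mapping.keys p. Poly_Mapping.single (a + w) (Poly_Mapping.lookup p a))"
    by (subst poly_mapping_sum_singles[of p, symmetric]) (simp add: sum_distrib_right mult_single)
  also have "Poly_Mapping.lookup \<dots> (m + w) =
      (\<Sum>a\<in>Poly_Mapping.keys p. if a = m then Poly_Mapping.lookup p a else 0)"
    unfolding lookup_sum lookup_single when_def by (intro sum.cong) auto
  also have "\<dots> = Poly_Mapping.lookup p m" by (simp add: in_keys_iff)
  finally show ?thesis .
qed

lemma var_mem_if_monomial_mem_prime:
  assumes V: "finite V" and P: "primeideal P (mpoly_ring V :: 'k::field mpoly ring)"
    and m: "Poly_Mapping.keys m \<subseteq> V" "Poly_Mapping.single m 1 \<in> P"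
  obtains i where "i \<in> Poly_Mapping.keys m" "mpoly_var i \<in> P"
proof -
  interpret P: primeideal P "mpoly_ring V :: 'k mpoly ring" by fact
  have "\<exists>i\<in>Poly_Mapping.keys m. mpoly_var i \<in> P"
    using m
  proof (induction "sum (Poly_Mapping.lookup m) V" arbitrary: m rule: less_induct)
    case less
    show ?case
    proof (cases "Poly_Mapping.keys m = {}")
      case True
      then have "\<one>\<^bsub>mpoly_ring V\<^esub> \<in> P" using less.prems by simp
      from P.one_imp_carrier[OF this] show ?thesis using P.I_notcarr by blast
    next
      case False
      then obtain i where i: "i \<in> Poly_Mapping.keys m" by blast
      define m' where "m' = m - Poly_Mapping.single i 1"
      have keys: "Poly_Mapping.keys m' \<subseteq> Poly_Mapping.keys m"
        unfolding m'_def by (rule keys_minus_nat_subset)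
      have iV: "i \<in> V" using i less.prems(1) by blast
      have c: "Poly_Mapping.single m' 1 \<in> carrier (mpoly_ring V :: 'k mpoly ring)"
        "mpoly_var i \<in> carrier (mpoly_ring V :: 'k mpoly ring)"
        unfolding mpoly_var_def using keys less.prems(1) iV by (auto intro!: single_mem_mpoly_ring)
      have "Poly_Mapping.single m' 1 \<otimes>\<^bsub>mpoly_ring V\<^esub> mpoly_var i \<in> P"
        using less.prems(2) single_eq_var_mult[OF i, of "1 :: 'k"] unfolding m'_def by simp
      from P.I_prime[OF c this] show ?thesis
      proof
        assume m'P: "Poly_Mapping.single m' 1 \<in> P"
        have "sum (Poly_Mapping.lookup m') V < sum (Poly_Mapping.lookup m) V"
        proof (rule sum_strict_mono_ex1[OF V])
          show "\<forall>x\<in>V. Poly_Mapping.lookup m' x \<le> Poly_Mapping.lookup m x"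
            unfolding m'_def lookup_minus by simp
          show "\<exists>x\<in>V. Poly_Mapping.lookup m' x < Poly_Mapping.lookup m x"
            using iV i unfolding m'_def lookup_minus by (intro bexI[of _ i]) (auto simp: in_keys_iff)
        qed
        from less.hyps[OF this _ m'P] keys less.prems(1) show ?thesis by blast
      qed (use i in blast)
    qed
  qed
  then show ?thesis using that by blast
qed

lemma ereal_le_Max_or_minus_infty:
  assumes "finite X" "x \<in> X"
  shows "x \<le> Max_or_minus_infty X"
  using Max_ge[OF assms] assms(2) by (cases "X = {}") (simp_all add: Max_or_minus_infty_def)

lemma Max_or_minus_infty_le:
  assumes "finite X" "\<And>x. x \<in> X \<Longrightarrow> x \<le> b"
  shows "Max_or_minus_infty X \<le> b"
proof (cases "X = {}")
  case False
  then have "Max X \<in> X" by (intro Max_in assms(1))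
  then show ?thesis using assms(2) False by (simp add: Max_or_minus_infty_def)
qed (simp add: Max_or_minus_infty_def)

definition symbolic_exponents :: "'a set \<Rightarrow> 'a rel \<Rightarrow> nat \<Rightarrow> ('a \<Rightarrow>\<^sub>0 nat) set" where
  "symbolic_exponents V E k = {m. \<forall>A\<subseteq>V. vertex_cover E A \<longrightarrow> k \<le> sum (Poly_Mapping.lookup m) A}"

lemma up_closed_symbolic_exponents: "up_closed (symbolic_exponents V E k)"
  unfolding up_closed_def symbolic_exponents_def
proof (intro ballI allI CollectI impI)
  fix m c A
  assume "m \<in> {m. \<forall>A\<subseteq>V. vertex_cover E A \<longrightarrow> k \<le> sum (Poly_Mapping.lookup m) A}"
    and "A \<subseteq> V" "vertex_cover E A"
  then have "k \<le> sum (Poly_Mapping.lookup m) A" by simp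
  also have "\<dots> \<le> sum (Poly_Mapping.lookup (m + c)) A" by (rule sum_mono) (simp add: lookup_add)
  finally show "k \<le> sum (Poly_Mapping.lookup (m + c)) A" .
qed

lemma up_closed_packs: "up_closed {m. packs E k (Poly_Mapping.lookup m)}"
  unfolding up_closed_def
proof (intro ballI allI)
  fix m c assume "m \<in> {m. packs E k (Poly_Mapping.lookup m)}"
  then have "packs E k (Poly_Mapping.lookup m)" by simp
  then have "packs E k (Poly_Mapping.lookup (m + c))"
    by (rule packs_mono) (simp add: lookup_add)
  then show "m + c \<in> {m. packs E k (Poly_Mapping.lookup m)}" by simp
qed

lemma ideal_annihilator:
  fixes I J :: "'k::field mpoly set"
  assumes I: "ideal I (mpoly_ring V)" and J: "ideal J (mpoly_ring V)"
  shows "ideal (annihilator (mpoly_ring V) (quotient_module (mpoly_ring V) J I)) (mpoly_ring V)"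
proof -
  interpret cring "mpoly_ring V :: 'k mpoly ring" by (rule cring_mpoly_ring)
  note iff = mem_annihilator_quotient_module_iff[OF I J]
  note Ic = mpoly_ideal_closed[OF I]
  show ?thesis
  proof (rule ideal_mpoly_ringI)
    show "annihilator (mpoly_ring V) (quotient_module (mpoly_ring V) J I) \<subseteq> carrier (mpoly_ring V)"
      using iff by blast
    show "0 \<in> annihilator (mpoly_ring V) (quotient_module (mpoly_ring V) J I)"
      unfolding iff by (simp add: zero_mem_mpoly_ring Ic(2))
    fix p q assume p: "p \<in> annihilator (mpoly_ring V) (quotient_module (mpoly_ring V) J I)"
    {
      assume "q \<in> annihilator (mpoly_ring V) (quotient_module (mpoly_ring V) J I)"
      then show "p + q \<in> annihilator (mpoly_ring V) (quotient_module (mpoly_ring V) J I)"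
        using p unfolding iff by (simp add: mpoly_ring_closed distrib_right Ic(3))
    }
    {
      assume "q \<in> carrier (mpoly_ring V :: 'k mpoly ring)"
      then show "q * p \<in> annihilator (mpoly_ring V) (quotient_module (mpoly_ring V) J I)"
        using p unfolding iff by (simp add: mpoly_ring_closed mult.assoc Ic(4))
    }
  qed
qed

section \<open>Induced cycles and independent sets as subgraphs\<close>

lemma dominates_induce_subgraph_iff:
  fixes G :: "('a, 'b) pre_digraph"
  shows
  "u \<rightarrow>\<^bsub>G \<restriction> W\<^esub> v \<longleftrightarrow> u \<rightarrow>\<^bsub>G\<^esub> v \<and> u \<in> W \<and> v \<in> W"
proof -
  have "u \<rightarrow>\<^bsub>H\<^esub> v \<longleftrightarrow> (\<exists>e\<in>arcs H. tail H e = u \<and> head H e = v)" for H :: "('a, 'b) pre_digraph"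
    unfolding arcs_ends_def arc_to_ends_def by force
  then show ?thesis by (auto simp: induce_subgraph_def)
qed

lemma induce_subgraph_mem_induced_odd_cycles:
  assumes "wf_digraph G" and E: "sym (arcs_ends G)"
    and vs: "induced_cycle (arcs_ends G) vs" "odd (length vs)" "length vs \<le> 2 * k - 1" "set vs \<subseteq> verts G"
  shows "G \<restriction> set vs \<in> induced_odd_cycles G k"
proof -
  interpret wf_digraph G by fact
  let ?n = "length vs"
  have dist: "distinct vs" and n3: "3 \<le> ?n"
    and iff: "\<And>i j. i < ?n \<Longrightarrow> j < ?n \<Longrightarrow>
      (vs ! i, vs ! j) \<in> arcs_ends G \<longleftrightarrow> j = Suc i mod ?n \<or> i = Suc j mod ?n"
    using vs(1) unfolding induced_cycle_def by auto
  have succ: "Suc i mod ?n < ?n" for i using n3 by (intro mod_less_divisor) linarith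
  have "arcs_ends (G \<restriction> set vs) =
      (\<Union>i<?n. {(vs ! i, vs ! (Suc i mod ?n)), (vs ! (Suc i mod ?n), vs ! i)})"
  proof (intro equalityI subsetI)
    fix e assume e: "e \<in> arcs_ends (G \<restriction> set vs)"
    obtain x y where xy: "e = (x, y)" by (cases e)
    from e have "x \<rightarrow>\<^bsub>G\<^esub> y" "x \<in> set vs" "y \<in> set vs"
      unfolding xy dominates_induce_subgraph_iff by auto
    then obtain i j where ij: "i < ?n" "j < ?n" "x = vs ! i" "y = vs ! j" "(vs ! i, vs ! j) \<in> arcs_ends G"
      by (auto simp: in_set_conv_nth)
    then show "e \<in> (\<Union>i<?n. {(vs ! i, vs ! (Suc i mod ?n)), (vs ! (Suc i mod ?n), vs ! i)})"
      using iff[OF ij(1,2)] unfolding xy by blast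
  next
    fix e assume "e \<in> (\<Union>i<?n. {(vs ! i, vs ! (Suc i mod ?n)), (vs ! (Suc i mod ?n), vs ! i)})"
    then obtain i where i: "i < ?n" "e = (vs ! i, vs ! (Suc i mod ?n)) \<or> e = (vs ! (Suc i mod ?n), vs ! i)"
      by blast
    have "(vs ! i, vs ! (Suc i mod ?n)) \<in> arcs_ends G" by (rule induced_cycle_edge[OF vs(1) i(1)])
    moreover from this have "(vs ! (Suc i mod ?n), vs ! i) \<in> arcs_ends G" by (rule symD[OF E])
    moreover have "vs ! i \<in> set vs" "vs ! (Suc i mod ?n) \<in> set vs"
      using i(1) succ by (auto intro: nth_mem)
    ultimately show "e \<in> arcs_ends (G \<restriction> set vs)"
      using i(2) by (auto simp: dominates_induce_subgraph_iff)
  qed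
  then have "cycle_graph (G \<restriction> set vs)"
    unfolding cycle_graph_def using dist n3 by (intro exI[of _ vs]) simp
  moreover have "induced_subgraph (G \<restriction> set vs) G"
    by (rule induced_induce) (rule vs(4))
  ultimately show ?thesis
    unfolding induced_odd_cycles_def using vs(2,3) dist by (simp add: distinct_card)
qed

lemma induced_odd_cyclesE:
  assumes "C \<in> induced_odd_cycles G k" and wf: "wf_digraph G"
  obtains vs where "induced_cycle (arcs_ends G) vs" "odd (length vs)" "length vs \<le> 2 * k - 1"
    "set vs = verts C" "set vs \<subseteq> verts G"
proof -
  have C: "induced_subgraph C G" "cycle_graph C" "odd (card (verts C))" "card (verts C) \<le> 2 * k - 1"
    using assms unfolding induced_odd_cycles_def by auto
  obtain vs where dist: "distinct vs" and n3: "3 \<le> length vs" and set: "verts C = set vs"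
    and ends: "arcs_ends C = (\<Union>i<length vs. {(vs ! i, vs ! (Suc i mod length vs)),
                           (vs ! (Suc i mod length vs), vs ! i)})"
    using C(2) unfolding cycle_graph_def by blast
  let ?n = "length vs"
  have succ: "Suc i mod ?n < ?n" for i using n3 by (intro mod_less_divisor) linarith
  have sub: "subgraph C G" using C(1) by blast
  have CG: "(x, y) \<in> arcs_ends C \<longleftrightarrow> (x, y) \<in> arcs_ends G" if "x \<in> set vs" "y \<in> set vs" for x y
  proof -
    have "arcs C = {e \<in> arcs G. tail G e \<in> verts C \<and> head G e \<in> verts C}"
      "tail C = tail G" "head C = head G"
      using C(1) sub unfolding induced_subgraph_def subgraph_def compatible_def by auto
    then show ?thesis using that set by (auto simp: arcs_ends_def arc_to_ends_def)
  qed
  have "induced_cycle (arcs_ends G) vs"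
    unfolding induced_cycle_def
  proof (intro conjI dist n3 allI impI)
    fix i j assume ij: "i < ?n" "j < ?n"
    have "(vs ! i, vs ! j) \<in> arcs_ends G \<longleftrightarrow> (vs ! i, vs ! j) \<in> arcs_ends C"
      using CG ij by simp
    also have "\<dots> \<longleftrightarrow> (\<exists>l<?n. vs ! i = vs ! l \<and> vs ! j = vs ! (Suc l mod ?n) \<or>
        vs ! i = vs ! (Suc l mod ?n) \<and> vs ! j = vs ! l)"
      unfolding ends by blast
    also have "\<dots> \<longleftrightarrow> (\<exists>l<?n. i = l \<and> j = Suc l mod ?n \<or> i = Suc l mod ?n \<and> j = l)"
      using nth_eq_iff_index_eq[OF dist] ij succ by (intro ex_cong1 conj_cong) auto
    also have "\<dots> \<longleftrightarrow> j = Suc i mod ?n \<or> i = Suc j mod ?n"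
      using ij by blast
    finally show "(vs ! i, vs ! j) \<in> arcs_ends G \<longleftrightarrow> j = Suc i mod ?n \<or> i = Suc j mod ?n" .
  qed
  moreover have "set vs \<subseteq> verts G" using sub set unfolding subgraph_def by blast
  ultimately show ?thesis using that C(3,4) dist set by (simp add: distinct_card)
qed

lemma independence_number_witness:
  fixes H :: "('a, 'e) pre_digraph"
  assumes "finite (verts H)"
  obtains U where "U \<subseteq> verts H" "\<And>u v. u \<in> U \<Longrightarrow> v \<in> U \<Longrightarrow> \<not> u \<rightarrow>\<^bsub>H\<^esub> v"
    "card U = independence_number H"
proof -
  let ?X = "{card U | U. U \<subseteq> verts H \<and> (\<forall>u\<in>U. \<forall>v\<in>U. \<not> u \<rightarrow>\<^bsub>H\<^esub> v)}"
  have "finite ?X" by (rule finite_subset[of _ "card ` Pow (verts H)"]) (use assms in auto)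
  moreover have "card ({} :: 'a set) \<in> ?X" by blast
  ultimately have "Max ?X \<in> ?X" by (intro Max_in) blast+
  then show ?thesis using that unfolding independence_number_def by auto
qed

lemma card_le_independence_number:
  assumes "finite (verts H)" "U \<subseteq> verts H" "\<And>u v. u \<in> U \<Longrightarrow> v \<in> U \<Longrightarrow> \<not> u \<rightarrow>\<^bsub>H\<^esub> v"
  shows "card U \<le> independence_number H"
  unfolding independence_number_def
proof (rule Max_ge)
  show "finite {card U | U. U \<subseteq> verts H \<and> (\<forall>u\<in>U. \<forall>v\<in>U. \<not> u \<rightarrow>\<^bsub>H\<^esub> v)}"
    by (rule finite_subset[of _ "card ` Pow (verts H)"]) (use assms(1) in auto)
  show "card U \<in> {card U | U. U \<subseteq> verts H \<and> (\<forall>u\<in>U. \<forall>v\<in>U. \<not> u \<rightarrow>\<^bsub>H\<^esub> v)}"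
    using assms(2,3) by blast
qed

section \<open>The dimension of the quotient\<close>

text \<open>The variables in \<open>U\<close> are added to the ideal one after the other.\<close>

lemma variable_ideal_chain:
  assumes A: "A \<union> U = V" "A \<inter> U = {}" "finite U"
  shows "\<exists>P :: nat \<Rightarrow> 'k::field mpoly set. P 0 = variable_ideal V A \<and>
    (\<forall>i. primeideal (P i) (mpoly_ring V)) \<and> (\<forall>i<card U. P i \<subset> P (Suc i))"
proof -
  obtain us where us: "distinct us" "set us = U"
    using finite_distinct_list[OF A(3)] by blast
  define P :: "nat \<Rightarrow> 'k mpoly set" where "P i = variable_ideal V (A \<union> set (take i us))" for i
  have "P i \<subset> P (Suc i)" if "i < card U" for i
  proof -
    have i: "i < length us" using that us distinct_card[of us] by simp
    have "set (take i us) \<subseteq> set (take (Suc i) us)" using i by (auto simp: take_Suc_conv_app_nth)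
    then have "P i \<subseteq> P (Suc i)" unfolding P_def by (intro variable_ideal_mono) blast
    moreover have uU: "us ! i \<in> U" using nth_mem[OF i] us(2) by simp
    then have uV: "us ! i \<in> V" "us ! i \<notin> A" using A by auto
    have "us ! i \<notin> set (take i us)"
      using us(1) i by (auto simp: in_set_conv_nth nth_eq_iff_index_eq)
    then have "mpoly_var (us ! i) \<notin> P i"
      unfolding P_def var_mem_variable_ideal_iff[OF uV(1)] using uV(2) by blast
    moreover have "mpoly_var (us ! i) \<in> P (Suc i)"
      unfolding P_def var_mem_variable_ideal_iff[OF uV(1)] using i by (simp add: take_Suc_conv_app_nth)
    ultimately show ?thesis by blast
  qed
  moreover have "P 0 = variable_ideal V A" by (simp add: P_def)
  moreover have "primeideal (P i) (mpoly_ring V)" for i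
    unfolding P_def by (rule primeideal_variable_ideal)
  ultimately show ?thesis by (intro exI[of _ P] conjI allI impI)
qed

context
  fixes n k :: nat and G :: "(nat, 'e) pre_digraph"
  assumes graph: "graph G" and V: "verts G = {1..n}"
begin

interpretation graph G by (fact graph)

abbreviation "power_ideal \<equiv>
  monomial_ideal {1..n} {m. packs (arcs_ends G) k (Poly_Mapping.lookup m)} :: 'k::field mpoly set"
abbreviation "symbolic_ideal \<equiv>
  monomial_ideal {1..n} (symbolic_exponents {1..n} (arcs_ends G) k) :: 'k::field mpoly set"

lemma edges: "arcs_ends G \<subseteq> {1..n} \<times> {1..n}" "sym (arcs_ends G)" "irrefl (arcs_ends G)"
proof -
  show "arcs_ends G \<subseteq> {1..n} \<times> {1..n}"
    using wellformed V by (auto simp: arcs_ends_def arc_to_ends_def)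
  show "sym (arcs_ends G)" using sym_arcs unfolding symmetric_def .
  show "irrefl (arcs_ends G)"
    using no_loops by (auto simp: irrefl_def arcs_ends_def arc_to_ends_def)
qed

text \<open>The upper bound. The monomial with exponent \<open>k\<close> on every variable outside \<open>P\<close> is not in \<open>P\<close> and hence
does not annihilate the quotient. This single monomial yields the weight to which
\<open>induced_odd_cycle_away_from\<close> applies.\<close>

lemma induced_odd_cycle_if_annihilator_subset_prime:
  fixes P :: "'k::field mpoly set"
  assumes P: "primeideal P (mpoly_ring {1..n})"
    and ann: "annihilator (mpoly_ring {1..n}) (quotient_module (mpoly_ring {1..n}) symbolic_ideal power_ideal) \<subseteq> P"
  obtains C where "C \<in> induced_odd_cycles G k"
    "card {i \<in> {1..n}. mpoly_var i \<notin> P} \<le>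
      independence_number (delete_verts G (closed_neighborhood G (verts C)))"
proof -
  let ?V = "{1..n}" and ?S = "mpoly_ring {1..n} :: 'k mpoly ring"
  interpret S: cring ?S by (rule cring_mpoly_ring)
  have idP: "ideal (power_ideal :: 'k mpoly set) ?S" by (rule ideal_monomial_ideal[OF up_closed_packs])
  have idS: "ideal (symbolic_ideal :: 'k mpoly set) ?S"
    by (rule ideal_monomial_ideal[OF up_closed_symbolic_exponents])
  define F where "F = {i \<in> ?V. mpoly_var i \<notin> P}"
  have FV: "F \<subseteq> ?V" unfolding F_def by blast
  define w where "w = Abs_poly_mapping (\<lambda>x. if x \<in> F then k else 0)"
  have "finite {x. (if x \<in> F then k else 0) \<noteq> 0}"
    by (rule finite_subset[of _ ?V]) (use FV in \<open>auto split: if_splits\<close>)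
  then have w: "Poly_Mapping.lookup w = (\<lambda>x. if x \<in> F then k else 0)"
    unfolding w_def by (rule lookup_Abs_poly_mapping)
  have keys_w: "Poly_Mapping.keys w \<subseteq> F" by (auto simp: in_keys_iff w split: if_splits)
  have wc: "(Poly_Mapping.single w 1 :: 'k mpoly) \<in> carrier ?S"
    by (rule single_mem_mpoly_ring) (use keys_w FV in blast)
  have "(Poly_Mapping.single w 1 :: 'k mpoly) \<notin> P"
  proof
    assume "Poly_Mapping.single w 1 \<in> P"
    then obtain i where "i \<in> Poly_Mapping.keys w" "mpoly_var i \<in> P"
      using var_mem_if_monomial_mem_prime[OF _ P, of w] keys_w FV by auto
    then show False using keys_w unfolding F_def by blast
  qed
  then have "(Poly_Mapping.single w 1 :: 'k mpoly) \<notin> annihilator ?S (quotient_module ?S (symbolic_ideal :: 'k mpoly set) power_ideal)"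
    using ann by blast
  then obtain f :: "'k mpoly" where f: "f \<in> symbolic_ideal" "Poly_Mapping.single w 1 * f \<notin> power_ideal"
    using wc unfolding S.mem_annihilator_quotient_module_iff[OF idP idS] by auto
  have "\<exists>a\<in>Poly_Mapping.keys f. \<not> packs (arcs_ends G) k (Poly_Mapping.lookup (w + a))"
  proof (rule ccontr)
    assume neg: "\<not> ?thesis"
    let ?X = "{f :: 'k mpoly. Poly_Mapping.single w 1 * f \<in> power_ideal}"
    have "f \<in> ?X"
    proof (rule mem_if_terms_mem)
      show "0 \<in> ?X"
        using mpoly_ideal_closed(2)[OF idP] by simp
      show "p + q \<in> ?X"
        if "p \<in> ?X"
          "q \<in> ?X" for p q
        using mpoly_ideal_closed(3)[OF idP] that by (simp add: distrib_left)
      fix a assume a: "a \<in> Poly_Mapping.keys f"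
      then have "Poly_Mapping.keys a \<subseteq> ?V" using f(1) unfolding monomial_ideal_def by blast
      then have "Poly_Mapping.keys (w + a) \<subseteq> ?V" using keys_w FV unfolding keys_add_nat by blast
      then show "Poly_Mapping.single a (Poly_Mapping.lookup f a) \<in> ?X"
        using neg a by (simp add: mult_single single_mem_monomial_ideal_iff)
    qed
    then show False using f(2) by blast
  qed
  then obtain a where a: "a \<in> Poly_Mapping.keys f" "\<not> packs (arcs_ends G) k (Poly_Mapping.lookup (w + a))"
    by blast
  have asym: "a \<in> symbolic_exponents ?V (arcs_ends G) k"
    using a(1) f(1) unfolding monomial_ideal_def by blast
  have "Poly_Mapping.lookup (w + a) = (\<lambda>x. Poly_Mapping.lookup a x + (if x \<in> F then k else 0))"
    by (rule ext) (simp add: lookup_add w)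
  then have np: "\<not> packs (arcs_ends G) k (\<lambda>x. Poly_Mapping.lookup a x + (if x \<in> F then k else 0))"
    using a(2) by simp
  have cov: "k \<le> sum (Poly_Mapping.lookup a) D" if "D \<subseteq> ?V" "vertex_cover (arcs_ends G) D" for D
    using asym that unfolding symbolic_exponents_def by blast
  obtain vs where vs: "induced_cycle (arcs_ends G) vs" "odd (length vs)" "length vs \<le> 2 * k - 1"
    "set vs \<subseteq> ?V" and Fvs: "set vs \<inter> F = {}" "arcs_ends G \<inter> set vs \<times> F = {}"
    and FF: "arcs_ends G \<inter> F \<times> F = {}"
    using induced_odd_cycle_away_from[OF _ edges FV cov np] by auto
  define C where "C = G \<restriction> set vs"
  have C: "C \<in> induced_odd_cycles G k"
    unfolding C_def using vs V edges(2)
    by (intro induce_subgraph_mem_induced_odd_cycles) (auto intro: wf_digraph_axioms)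
  let ?H = "delete_verts G (closed_neighborhood G (verts C))"
  have vC: "verts C = set vs" unfolding C_def by simp
  have vH: "verts ?H = verts G - closed_neighborhood G (verts C)"
    unfolding delete_verts_def by simp
  have "card F \<le> independence_number ?H"
  proof (rule card_le_independence_number)
    show "finite (verts ?H)" unfolding vH using V by simp
    show "F \<subseteq> verts ?H"
    proof
      fix x assume x: "x \<in> F"
      then have "x \<in> verts G" "x \<notin> set vs" using FV V Fvs(1) by auto
      moreover have "\<not> u \<rightarrow>\<^bsub>G\<^esub> x" if "u \<in> set vs" for u
        using that x Fvs(2) by blast
      ultimately show "x \<in> verts ?H" unfolding vH unfolding vC closed_neighborhood_def by auto
    qed
    show "\<not> u \<rightarrow>\<^bsub>?H\<^esub> v" if "u \<in> F" "v \<in> F" for u v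
      using that FF unfolding delete_verts_def dominates_induce_subgraph_iff by blast
  qed
  then show ?thesis using that C unfolding F_def by blast
qed

text \<open>The lower bound. An element of the annihilator multiplies the monomial \<open>cycle_weight vs k\<close> into the
power of the edge ideal, term by term, and a term in the variables of \<open>U\<close> alone cannot do this.\<close>

lemma annihilator_subset_variable_ideal:
  assumes C: "C \<in> induced_odd_cycles G k"
    and U: "U \<subseteq> verts (delete_verts G (closed_neighborhood G (verts C)))"
      "\<And>u v. u \<in> U \<Longrightarrow> v \<in> U \<Longrightarrow> \<not> u \<rightarrow>\<^bsub>delete_verts G (closed_neighborhood G (verts C))\<^esub> v"
  shows "annihilator (mpoly_ring {1..n}) (quotient_module (mpoly_ring {1..n}) symbolic_ideal power_ideal)
    \<subseteq> (variable_ideal {1..n} ({1..n} - U) :: 'k::field mpoly set)"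
proof
  let ?V = "{1..n}" and ?S = "mpoly_ring {1..n} :: 'k mpoly ring"
  interpret S: cring ?S by (rule cring_mpoly_ring)
  have idP: "ideal (power_ideal :: 'k mpoly set) ?S" by (rule ideal_monomial_ideal[OF up_closed_packs])
  have idS: "ideal (symbolic_ideal :: 'k mpoly set) ?S"
    by (rule ideal_monomial_ideal[OF up_closed_symbolic_exponents])
  obtain vs where vs: "induced_cycle (arcs_ends G) vs" "odd (length vs)" "length vs \<le> 2 * k - 1"
    "set vs = verts C" "set vs \<subseteq> verts G"
    using induced_odd_cyclesE[OF C wf_digraph_axioms] .
  have UV: "U \<subseteq> ?V - closed_neighborhood G (set vs)"
    using U(1) unfolding delete_verts_def vs(4) by (simp add: V)
  have disj: "U \<inter> set vs = {}" using UV unfolding closed_neighborhood_def by blast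
  have UU: "arcs_ends G \<inter> U \<times> (set vs \<union> U) = {}"
  proof (rule ccontr)
    assume "\<not> ?thesis"
    then obtain x y where xy: "x \<in> U" "y \<in> set vs \<union> U" "x \<rightarrow>\<^bsub>G\<^esub> y" by blast
    then have "y \<rightarrow>\<^bsub>G\<^esub> x" using symD[OF edges(2)] by blast
    then have "y \<notin> set vs" using xy(1) UV V unfolding closed_neighborhood_def by blast
    then have "y \<in> U" using xy(2) by blast
    then show False
      using U(2)[OF xy(1)] xy(1,3) UV V unfolding delete_verts_def dominates_induce_subgraph_iff vs(4)
      by blast
  qed
  fix r :: "'k mpoly"
  assume r: "r \<in> annihilator ?S (quotient_module ?S (symbolic_ideal :: 'k mpoly set) power_ideal)"
  define w where "w = Abs_poly_mapping (cycle_weight vs k)"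
  have n3: "3 \<le> length vs" using vs(1) unfolding induced_cycle_def by blast
  then have in_vs: "vs ! 0 \<in> set vs" "vs ! 1 \<in> set vs" by (auto intro!: nth_mem)
  have supp: "x \<in> set vs" if "cycle_weight vs k x \<noteq> 0" for x
    using that in_vs unfolding cycle_weight_def by (cases "x \<in> set vs") auto
  then have "{x. cycle_weight vs k x \<noteq> 0} \<subseteq> set vs" by blast
  then have "finite {x. cycle_weight vs k x \<noteq> 0}" by (rule finite_subset) simp
  then have w: "Poly_Mapping.lookup w = cycle_weight vs k"
    unfolding w_def by (rule lookup_Abs_poly_mapping)
  have keys_w: "Poly_Mapping.keys w \<subseteq> set vs" using supp by (auto simp: in_keys_iff w)
  have cov: "k \<le> sum (cycle_weight vs k) D" if "D \<subseteq> ?V" "vertex_cover (arcs_ends G) D" for D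
    using cycle_weight_vertex_cover[OF edges(2) vs(1-3) finite_subset[OF that(1)] that(2)] by simp
  have "w \<in> symbolic_exponents ?V (arcs_ends G) k"
    unfolding symbolic_exponents_def
  proof (intro CollectI allI impI)
    fix D assume "D \<subseteq> ?V" "vertex_cover (arcs_ends G) D"
    then show "k \<le> sum (Poly_Mapping.lookup w) D" unfolding w by (rule cov)
  qed
  then have "Poly_Mapping.single w 1 \<in> (symbolic_ideal :: 'k mpoly set)"
    unfolding single_mem_monomial_ideal_iff using keys_w vs(5) V by blast
  then have rw: "r * Poly_Mapping.single w 1 \<in> power_ideal" and rc: "r \<in> carrier ?S"
    using r unfolding S.mem_annihilator_quotient_module_iff[OF idP idS] by auto
  show "r \<in> variable_ideal ?V (?V - U)"
    unfolding variable_ideal_def monomial_ideal_def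
  proof (intro CollectI ballI conjI notI)
    fix m assume m: "m \<in> Poly_Mapping.keys r"
    show mV: "Poly_Mapping.keys m \<subseteq> ?V" using rc m unfolding mem_mpoly_ring_iff by blast
    assume "Poly_Mapping.keys m \<inter> (?V - U) = {}"
    then have mU: "Poly_Mapping.keys m \<subseteq> U" using mV by blast
    have "m + w \<in> Poly_Mapping.keys (r * Poly_Mapping.single w 1)"
      using m unfolding in_keys_iff lookup_mult_single_shift .
    then have "packs (arcs_ends G) k (Poly_Mapping.lookup (m + w))"
      using rw unfolding monomial_ideal_def by blast
    moreover have "Poly_Mapping.lookup (m + w) = (\<lambda>x. cycle_weight vs k x + Poly_Mapping.lookup m x)"
      by (rule ext) (simp add: lookup_add w)
    moreover have "x \<in> U" if "0 < Poly_Mapping.lookup m x" for x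
      using that mU by (auto simp: in_keys_iff)
    ultimately show False
      using not_packs_cycle_weight[OF edges(2) vs(1-3) UU disj, of "Poly_Mapping.lookup m"] by simp
  qed
qed

end

theorem theorem1p8:
  fixes n k :: nat
    and G :: "(nat, 'e) pre_digraph"
    and S :: "'k::field mpoly ring"
    and I :: "'k mpoly set"
  assumes "graph G" and "verts G = {1..n}" and "k \<ge> 1"
    and "S = mpoly_ring {1..n}" and "I = edge_ideal n G"
  shows "module_dim S (quotient_module S (symbolic_power S I k) (I [^]\<^bsub>ideals_set S\<^esub> k)) =
    Max_or_minus_infty
      ((\<lambda>C. ereal (real (independence_number
               (delete_verts G (closed_neighborhood G (verts C)))))) ` induced_odd_cycles G k)"
proof -
  interpret graph G by fact
  note graph = assms(1,2)
  interpret S: cring S unfolding assms(4) by (rule cring_mpoly_ring)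
  let ?V = "{1..n}"
  define J :: "'k mpoly set" where "J = monomial_ideal ?V (symbolic_exponents ?V (arcs_ends G) k)"
  define L :: "'k mpoly set" where "L = monomial_ideal ?V {m. packs (arcs_ends G) k (Poly_Mapping.lookup m)}"
  have J: "symbolic_power S I k = J"
    unfolding assms(4,5) J_def symbolic_exponents_def
    by (rule symbolic_power_edge_ideal[OF edges(1)[OF graph]])
  have L: "I [^]\<^bsub>ideals_set S\<^esub> k = L"
    unfolding assms(4,5) L_def by (rule edge_ideal_power[OF edges(1)[OF graph]])
  define A where "A = annihilator S (quotient_module S J L)"
  have idA: "ideal A S"
    unfolding A_def J_def L_def assms(4)
    by (intro ideal_annihilator ideal_monomial_ideal up_closed_packs up_closed_symbolic_exponents)
  define \<alpha> where "\<alpha> C = ereal (real (independence_number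
    (delete_verts G (closed_neighborhood G (verts C)))))" for C :: "(nat, 'e) pre_digraph"
  have fin: "finite (\<alpha> ` induced_odd_cycles G k)"
    using finite_induced_odd_cycles[OF fin_digraph_axioms] by simp
  let ?D = "{ereal (real d) | d P. (\<forall>i\<le>d. primeideal (P i) S) \<and> A \<subseteq> P 0 \<and> (\<forall>i<d. P i \<subset> P (Suc i))}"
  have "Sup ?D = Max_or_minus_infty (\<alpha> ` induced_odd_cycles G k)"
  proof (rule antisym)
    show "Sup ?D \<le> Max_or_minus_infty (\<alpha> ` induced_odd_cycles G k)"
    proof (rule Sup_least)
      fix x assume "x \<in> ?D"
      then obtain d P where x: "x = ereal (real d)" and P: "\<And>i. i \<le> d \<Longrightarrow> primeideal (P i) S"
        "A \<subseteq> P 0" "\<And>i. i < d \<Longrightarrow> P i \<subset> P (Suc i)" by blast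
      have "d \<le> card {i \<in> ?V. mpoly_var i \<notin> P 0}"
        using P(1,3) unfolding assms(4) by (intro prime_chain_length_le) auto
      moreover obtain C where C: "C \<in> induced_odd_cycles G k"
        "card {i \<in> ?V. mpoly_var i \<notin> P 0} \<le>
          independence_number (delete_verts G (closed_neighborhood G (verts C)))"
        using induced_odd_cycle_if_annihilator_subset_prime[OF graph, of "P 0" k] P(1)[of 0] P(2)
        unfolding A_def J_def L_def assms(4) by auto
      ultimately have "x \<le> \<alpha> C" unfolding x \<alpha>_def by simp
      also have "\<dots> \<le> Max_or_minus_infty (\<alpha> ` induced_odd_cycles G k)"
        using fin C(1) by (intro ereal_le_Max_or_minus_infty) auto
      finally show "x \<le> Max_or_minus_infty (\<alpha> ` induced_odd_cycles G k)" .
    qed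
    show "Max_or_minus_infty (\<alpha> ` induced_odd_cycles G k) \<le> Sup ?D"
    proof (rule Max_or_minus_infty_le[OF fin])
      fix x assume "x \<in> \<alpha> ` induced_odd_cycles G k"
      then obtain C where C: "C \<in> induced_odd_cycles G k" "x = \<alpha> C" by blast
      let ?H = "delete_verts G (closed_neighborhood G (verts C))"
      have "finite (verts ?H)" unfolding delete_verts_def using assms(2) by simp
      then obtain U where U: "U \<subseteq> verts ?H" "\<And>u v. u \<in> U \<Longrightarrow> v \<in> U \<Longrightarrow> \<not> u \<rightarrow>\<^bsub>?H\<^esub> v"
        "card U = independence_number ?H"
        using independence_number_witness by blast
      have UV: "U \<subseteq> ?V" using U(1) assms(2) unfolding delete_verts_def by auto
      have AU: "A \<subseteq> variable_ideal ?V (?V - U)"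
        unfolding A_def J_def L_def assms(4)
        by (rule annihilator_subset_variable_ideal[OF graph C(1) U(1,2)])
      have "finite U" using UV finite_subset by blast
      have compl: "?V - U \<union> U = ?V" "(?V - U) \<inter> U = {}" using UV by auto
      from variable_ideal_chain[OF compl \<open>finite U\<close>]
      obtain P :: "nat \<Rightarrow> 'k mpoly set" where P: "P 0 = variable_ideal ?V (?V - U) \<and>
          (\<forall>i. primeideal (P i) (mpoly_ring ?V)) \<and> (\<forall>i<card U. P i \<subset> P (Suc i))" ..
      have "ereal (real (card U)) \<in> ?D"
      proof (rule CollectI, rule exI[of _ "card U"], rule exI[of _ P], rule conjI[OF refl], intro conjI)
        show "\<forall>i\<le>card U. primeideal (P i) S" unfolding assms(4) using P by simp
        show "A \<subseteq> P 0" using P AU by simp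
        show "\<forall>i<card U. P i \<subset> P (Suc i)" using P by (elim conjE)
      qed
      then show "x \<le> Sup ?D" unfolding C(2) \<alpha>_def U(3)[symmetric] by (rule Sup_upper)
    qed
  qed
  then show ?thesis
    unfolding module_dim_def J L A_def[symmetric] S.krull_dim_quot[OF idA] \<alpha>_def .
qed

end
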